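(* Let $1<p<\infty$ and $r>0$ with $p\ne r$. Then there is a constant $C$, independent of the sparse family and of the weights, such that for every sparse collection $\mathcal S$ of dyadic cubes and every pair of weights $w,\sigma$ on $\mathbb R^n$, $$\|A_{\mathcal S}^r(\cdot\,\sigma)\|_{L^p(\sigma)\to L^{p,\infty}(w)}\le C\,[w,\sigma]_{A_p}^{\frac1p}\,[w]_{A_\infty}^{(\frac1r-\frac1p)_+}.$$
   Context: Work in $\mathbb R^n$ with a fixed system $\mathcal D$ of dyadic cubes. A weight is a locally integrable, a.e. positive function; $w(E)=\int_E w\,dx$, and $L^p(w)$, $L^{p,\infty}(w)$ are taken with respect to the measure $w\,dx$, with $\|g\|_{L^{p,\infty}(w)}=\sup_{t>0}t\,w(\{|g|>t\})^{1/p}$. For a cube $Q$, $\langle f\rangle_Q:=\frac1{|Q|}\int_Q f\,dx$. A collection $\mathcal S\subset\mathcal D$ is sparse if there are pairwise disjoint subsets $E(S)\subset S$, $S\in\mathcal S$, with $|E(S)|\ge\frac12|S|$. For $r>0$ and $f\ge0$, $$A_{\mathcal S}^r(f):=\Big(\sum_{Q\in\mathcal S}\langle f\rangle_Q^r\,\mathbf 1_Q\Big)^{1/r}.$$ $\|A_{\mathcal S}^r(\cdot\,\sigma)\|_{L^p(\sigma)\to L^{p,\infty}(w)}$ is the least constant $N\in[0,\infty]$ such that $\|A_{\mathcal S}^r(f\sigma)\|_{L^{p,\infty}(w)}\le N\|f\|_{L^p(\sigma)}$ for all nonnegative $f\in L^p(\sigma)$. The (dyadic) weight characteristics are $$[w,\sigma]_{A_p}:=\sup_{Q\in\mathcal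 D}\langle w\rangle_Q\langle\sigma\rangle_Q^{p-1},\qquad [w]_{A_\infty}:=\sup_{Q\in\mathcal D}\frac1{w(Q)}\int_Q M(\mathbf 1_Q w)\,dx,$$ where $M f=\sup_{Q\in\mathcal D}\langle |f|\rangle_Q\mathbf 1_Q$ is the dyadic maximal operator. Notation: $x_+=\max(x,0)$. By convention $[w]_{A_\infty}^0=1$, whether or not $[w]_{A_\infty}$ is finite. *)

theory Defs
  imports "HOL-Analysis.Analysis"
begin

section \<open>Dyadic systems and sparse families\<close>

definition half_open_cube :: "real ^ 'n \<Rightarrow> real \<Rightarrow> (real ^ 'n) set" where
  "half_open_cube a l = {x. \<forall>i. a $ i \<le> x $ i \<and> x $ i < a $ i + l}"

text \<open>
  The cubes of generation \<open>k\<close> have side length \<open>2 powi (-k)\<close> and tile the whole space.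
  Since both \<open>G k\<close> and \<open>G (k + 1)\<close> are partitions, the last clause says that every cube of
  generation \<open>k\<close> is the union of the cubes of generation \<open>k + 1\<close> contained in it.
\<close>
definition dyadic_system :: "(real ^ 'n) set set \<Rightarrow> bool" where
  "dyadic_system D \<longleftrightarrow>
     (\<exists>G :: int \<Rightarrow> (real ^ 'n) set set.
        D = (\<Union>k. G k) \<and>
        (\<forall>k. partition_on UNIV (G k)) \<and>
        (\<forall>k. \<forall>Q \<in> G k. \<exists>a. Q = half_open_cube a (2 powi (- k))) \<and>
        (\<forall>k. \<forall>Q \<in> G (k + 1). \<exists>R \<in> G k. Q \<subseteq> R))"

text \<open>The standard dyadic cubes form such a system, with lower corners \<open>m * 2 powi (-k)\<close>.\<close>
lemma dyadic_system_standard: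
  "dyadic_system (\<Union>k :: int. range (\<lambda>m :: int ^ 'n.
     half_open_cube (\<chi> i. of_int (m $ i) * 2 powi (- k)) (2 powi (- k))))"
proof -
  define c :: "int \<Rightarrow> int ^ 'n \<Rightarrow> (real ^ 'n) set"
    where "c = (\<lambda>k m. half_open_cube (\<chi> i. of_int (m $ i) * 2 powi (- k)) (2 powi (- k)))"
  have mem: "x \<in> c k m \<longleftrightarrow> (\<forall>i. m $ i = \<lfloor>x $ i * 2 powi k\<rfloor>)" for x k m
    unfolding c_def half_open_cube_def
    by (simp add: power_int_minus field_simps eq_commute[of "m $ _"] floor_eq_iff) 
  have mem': "x \<in> c k (\<chi> i. \<lfloor>x $ i * 2 powi k\<rfloor>)" for x k
    by (simp add: mem)
  have uniq: "x \<in> c k m \<Longrightarrow> x \<in> c k m' \<Longrightarrow> m = m'" for x k m m'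
    by (simp add: mem vec_eq_iff)
  have ne: "c k m \<noteq> {}" for k m
  proof -
    have "(\<chi> i. of_int (m $ i) * 2 powi (- k)) \<in> c k m"
      by (simp add: mem power_int_minus mult.assoc)
    then show ?thesis by blast
  qed
  have part: "partition_on UNIV (range (c k))" for k
    unfolding partition_on_def disjoint_def
    using mem' uniq[of _ k] ne by (auto, blast+)
  have nest: "c (k + 1) m \<subseteq> c k (\<chi> i. m $ i div 2)" for k m
  proof
    fix x assume x: "x \<in> c (k + 1) m"
    have "\<lfloor>x $ i * 2 powi (k + 1)\<rfloor> div 2 = \<lfloor>x $ i * 2 powi k\<rfloor>" for i
      using floor_divide_real_eq_div[of 2 "x $ i * 2 powi (k + 1)"] by (simp add: power_int_add)
    with x show "x \<in> c k (\<chi> i. m $ i div 2)"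
      by (simp add: mem)
  qed
  have "dyadic_system (\<Union>k. range (c k))"
    unfolding dyadic_system_def
  proof (intro exI[of _ "\<lambda>k. range (c k)"] conjI allI ballI)
    fix k Q assume "Q \<in> range (c k)"
    then show "\<exists>a. Q = half_open_cube a (2 powi (- k))" by (auto simp: c_def)
  next
    fix k Q assume "Q \<in> range (c (k + 1))"
    then show "\<exists>R \<in> range (c k). Q \<subseteq> R" using nest by blast
  qed (use part in auto)
  then show ?thesis by (simp add: c_def)
qed

definition sparse_family :: "(real ^ 'n) set set \<Rightarrow> bool" where
  "sparse_family S \<longleftrightarrow>
     (\<exists>E. disjoint_family_on E S \<and>
        (\<forall>Q \<in> S. E Q \<in> sets lebesgue \<and> E Q \<subseteq> Q \<and>
                  emeasure lebesgue (E Q) \<ge> emeasure lebesgue Q / 2))"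

section \<open>Powers of extended nonnegative reals\<close>

text \<open>
  Only exponents \<open>a \<ge> 0\<close> are used. The first case gives \<open>x\<^sup>0 = 1\<close> for every \<open>x\<close>,
  including \<open>x = \<infinity>\<close>; it also overrides the library value \<open>0 powr 0 = 0\<close>.
\<close>
definition enn_powr :: "ennreal \<Rightarrow> real \<Rightarrow> ennreal" (infixr \<open>epowr\<close> 80) where
  "x epowr a = (if a = 0 then 1 else if x = \<infinity> then \<infinity> else ennreal (enn2real x powr a))"

section \<open>Weights, weighted spaces and the sparse operators\<close>

definition weight :: "(real ^ 'n \<Rightarrow> real) \<Rightarrow> bool" where
  "weight w \<longleftrightarrow>
     (\<forall>K. compact K \<longrightarrow> set_integrable lebesgue K w) \<and> (AE x in lebesgue. 0 < w x)"

definition weight_measure :: "(real ^ 'n \<Rightarrow> real) \<Rightarrow> (real ^ 'n) measure" where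
  "weight_measure w = density lebesgue (\<lambda>x. ennreal (w x))"

text \<open>Averages are only taken of functions that are nonnegative almost everywhere.\<close>
definition average :: "(real ^ 'n \<Rightarrow> real) \<Rightarrow> (real ^ 'n) set \<Rightarrow> ennreal" where
  "average f Q = (\<integral>\<^sup>+x\<in>Q. ennreal (f x) \<partial>lebesgue) / emeasure lebesgue Q"

definition Lp_norm :: "real \<Rightarrow> 'a measure \<Rightarrow> ('a \<Rightarrow> real) \<Rightarrow> ennreal" where
  "Lp_norm p M f = (\<integral>\<^sup>+x. ennreal (\<bar>f x\<bar> powr p) \<partial>M) epowr (1 / p)"

definition Lp_space :: "real \<Rightarrow> 'a measure \<Rightarrow> ('a \<Rightarrow> real) set" where
  "Lp_space p M = {f \<in> borel_measurable M. Lp_norm p M f < \<infinity>}"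

definition weak_Lp_norm :: "real \<Rightarrow> 'a measure \<Rightarrow> ('a \<Rightarrow> ennreal) \<Rightarrow> ennreal" where
  "weak_Lp_norm p M g =
     (SUP t \<in> {0 :: real <..}.
        ennreal t * emeasure M {x \<in> space M. g x > ennreal t} epowr (1 / p))"

definition sparse_operator ::
    "real \<Rightarrow> (real ^ 'n) set set \<Rightarrow> (real ^ 'n \<Rightarrow> real) \<Rightarrow> real ^ 'n \<Rightarrow> ennreal" where
  "sparse_operator r S f x =
     (\<Sum>\<^sub>\<infinity>Q\<in>S. average f Q epowr r * indicator Q x) epowr (1 / r)"

definition sparse_operator_norm ::
    "real \<Rightarrow> real \<Rightarrow> (real ^ 'n) set set \<Rightarrow> (real ^ 'n \<Rightarrow> real) \<Rightarrow> (real ^ 'n \<Rightarrow> real) \<Rightarrow> ennreal"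
  where
  "sparse_operator_norm r p S \<sigma> w =
     Inf {N. \<forall>f \<in> Lp_space p (weight_measure \<sigma>). (\<forall>x. 0 \<le> f x) \<longrightarrow>
            weak_Lp_norm p (weight_measure w) (sparse_operator r S (\<lambda>x. f x * \<sigma> x))
              \<le> N * Lp_norm p (weight_measure \<sigma>) f}"

section \<open>Weight characteristics\<close>

definition Ap_char ::
    "(real ^ 'n) set set \<Rightarrow> real \<Rightarrow> (real ^ 'n \<Rightarrow> real) \<Rightarrow> (real ^ 'n \<Rightarrow> real) \<Rightarrow> ennreal" where
  "Ap_char D p w \<sigma> = (SUP Q \<in> D. average w Q * average \<sigma> Q epowr (p - 1))"

definition dyadic_maximal ::
    "(real ^ 'n) set set \<Rightarrow> (real ^ 'n \<Rightarrow> real) \<Rightarrow> real ^ 'n \<Rightarrow> ennreal" where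
  "dyadic_maximal D f x = (SUP Q \<in> D. average (\<lambda>y. \<bar>f y\<bar>) Q * indicator Q x)"

definition Ainf_char :: "(real ^ 'n) set set \<Rightarrow> (real ^ 'n \<Rightarrow> real) \<Rightarrow> ennreal" where
  "Ainf_char D w =
     (SUP Q \<in> D. (\<integral>\<^sup>+x\<in>Q. dyadic_maximal D (\<lambda>y. indicator Q y * w y) x \<partial>lebesgue)
                   / emeasure (weight_measure w) Q)"

end

theory Submission
  imports Defs
begin

text \<open>
  Write \<open>\<langle>f\<sigma>\<rangle>\<^sub>Q\<close> for the averages in the operator, \<open>[w,\<sigma>]\<close> for the joint characteristic and \<open>[w]\<close> for the
  \<open>A\<^sub>\<infinity>\<close> characteristic. The cubes of \<open>S\<close> are sorted by the size of their averages: a level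
  collects the cubes \<open>Q\<close> with \<open>L < \<langle>f\<sigma>\<rangle>\<^sub>Q \<le> 2L\<close>, and \<open>N\<^sub>L x\<close> counts the cubes of the level that
  contain \<open>x\<close>. Two facts about a single level carry the proof.

  First, the total mass of a level is small: \<open>\<Sum>\<^sub>Q w(Q) \<le> c [w,\<sigma>] \<parallel>f\<parallel>\<^sup>p L powr (-p)\<close>
  (\<open>weight_level_sum_le\<close>). Inside a level the averages are comparable, so the Lebesgue packing of
  a sparse family is also a packing for the measure \<open>f \<sigma> dx\<close>. By the Markov inequality, at least half
  of the \<open>f \<sigma>\<close> mass of \<open>Q\<close> then lies on points that are in at most eight cubes of the level
  below \<open>Q\<close>. These parts of the cubes overlap at most eight times (\<open>emeasure_le_shallow\<close>,
  \<open>sum_emeasure_shallow_le\<close>), and Hoelder's inequality on each of them, combined with the joint \<open>A\<^sub>p\<close>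
  bound, gives \<open>w(Q) L powr p \<le> 2 powr p [w,\<sigma>] \<integral> f powr p d\<sigma>\<close> over the part.

  Second, overlaps have good tails: \<open>\<integral> N\<^sub>L ^ q dw \<le> q! (2 [w]) ^ (q - 1) \<Sum>\<^sub>Q w(Q)\<close> for \<open>q \<ge> 1\<close>
  (\<open>nn_integral_overlap_power\<close>), because \<open>[w]\<close> turns sparseness into a packing condition for \<open>w\<close>
  (\<open>carleson_weight\<close>).

  It remains to sum over the levels (\<open>emeasure_level_sum_le\<close>). With the levels \<open>L = t W powr (-1/r) 2 powr k\<close>
  the operator can exceed \<open>t\<close> at \<open>x\<close> only if \<open>N\<^sub>L x\<close> exceeds a threshold of order
  \<open>W 2 powr (-rk - \<delta>|k|)\<close> for some integer \<open>k\<close>. The tail bound with exponent \<open>q\<close> contributes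
  \<open>2 powr (k (qr - p))\<close>, up to a factor \<open>2 powr (\<delta>q|k|)\<close>, so an
  exponent above \<open>p/r\<close> is used for \<open>k < 0\<close>, one below \<open>p/r\<close> for \<open>k \<ge> 0\<close>, and the sum is geometric on both sides. When \<open>r < p\<close> the lower exponent is \<open>1\<close>, and
  \<open>W = [w]\<close> is the scale at which the two tail bounds balance; it produces \<open>[w] powr (p/r - 1)\<close>,
  whose \<open>p\<close>-th root is the factor in the theorem. When \<open>p < r\<close> the exponents \<open>0\<close> and \<open>1\<close> suffice,
  both tail bounds are free of \<open>[w]\<close>, and \<open>W = 1\<close>.
\<close>

section \<open>Overlap counts of nested families\<close>

definition nested :: "'a set set \<Rightarrow> bool" where
  "nested F \<longleftrightarrow> (\<forall>A\<in>F. \<forall>B\<in>F. A \<subseteq> B \<or> B \<subseteq> A \<or> A \<inter> B = {})"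

definition overlap :: "'a set set \<Rightarrow> 'a \<Rightarrow> nat" where
  "overlap F x = card {Q \<in> F. x \<in> Q}"

definition below :: "'a set set \<Rightarrow> 'a set \<Rightarrow> 'a set set" where
  "below F Q = {R \<in> F. R \<subseteq> Q}"

lemma nested_subset: "nested F \<Longrightarrow> G \<subseteq> F \<Longrightarrow> nested G"
  unfolding nested_def by blast

lemma below_subset: "below F Q \<subseteq> F"
  unfolding below_def by blast

lemma below_below: "R \<in> below F Q \<Longrightarrow> below (below F Q) R = below F R"
  unfolding below_def by blast

lemma of_nat_overlap_eq:
  assumes "finite F"
  shows "of_nat (overlap F x) = (\<Sum>Q\<in>F. indicator Q x :: 'b :: semiring_1)"
  using assms by (simp add: overlap_def indicator_def sum.If_cases Int_def conj_commute)

lemma measurable_overlap [measurable]: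
  assumes "finite F" "F \<subseteq> sets M"
  shows "(\<lambda>x. overlap F x) \<in> measurable M (count_space UNIV)"
proof -
  have "(\<lambda>x. real (overlap F x)) \<in> borel_measurable M"
    unfolding of_nat_overlap_eq[OF assms(1)] using assms(2) by (intro borel_measurable_sum) auto
  then have "(\<lambda>x. nat \<lfloor>real (overlap F x)\<rfloor>) \<in> measurable M (count_space UNIV)"
    by measurable
  then show ?thesis by simp
qed

text \<open>
  The cubes through \<open>x\<close> form a finite chain, and the overlap of the cubes below \<open>Q\<close> at \<open>x\<close> is
  the rank of \<open>Q\<close> in this chain, counted from the smallest cube.
\<close>
lemma bij_betw_overlap_below:
  assumes "finite F" "nested F"
  shows "bij_betw (\<lambda>Q. overlap (below F Q) x) {Q \<in> F. x \<in> Q} {1..overlap F x}"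
proof -
  let ?C = "{Q \<in> F. x \<in> Q}"
  let ?h = "\<lambda>Q. overlap (below F Q) x"
  have h: "?h Q = card {R \<in> ?C. R \<subseteq> Q}" for Q
    by (simp add: overlap_def below_def conj_ac)
  have mono: "?h Q < ?h R" if "Q \<in> ?C" "R \<in> ?C" "Q \<subset> R" for Q R
    unfolding h using assms(1) that by (intro psubset_card_mono) auto
  have inj: "inj_on ?h ?C"
  proof (rule inj_onI)
    fix Q R assume *: "Q \<in> ?C" "R \<in> ?C" "?h Q = ?h R"
    then have "Q \<subseteq> R \<or> R \<subseteq> Q" using assms(2) unfolding nested_def by blast
    with * mono[of Q R] mono[of R Q] show "Q = R" by auto
  qed
  have sub: "?h ` ?C \<subseteq> {1..overlap F x}"
  proof (rule image_subsetI)
    fix Q assume Q: "Q \<in> ?C"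
    have "card {Q} \<le> ?h Q"
      unfolding h using Q assms(1) by (intro card_mono) auto
    moreover have "?h Q \<le> overlap F x"
      unfolding overlap_def using assms(1) below_subset[of F Q] by (intro card_mono) auto
    ultimately show "?h Q \<in> {1..overlap F x}" by simp
  qed
  have "card (?h ` ?C) = card {1..overlap F x}"
    using card_image[OF inj] by (simp add: overlap_def)
  then have "?h ` ?C = {1..overlap F x}" using sub by (intro card_subset_eq) auto
  with inj show ?thesis by (simp add: bij_betw_def)
qed

lemma power_Suc_le_sum_powers:
  "(n :: nat) ^ Suc q \<le> Suc q * (\<Sum>j = 1..n. j ^ q)"
proof (induction n)
  case (Suc n)
  have "Suc n ^ Suc q \<le> n ^ Suc q + Suc q * Suc n ^ q"
  proof (induction q)
    case (Suc q)
    have "Suc n ^ Suc (Suc q) \<le> Suc n * (n ^ Suc q + Suc q * Suc n ^ q)"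
      using mult_le_mono2[OF Suc] by (simp only: power_Suc)
    also have "\<dots> = n ^ Suc (Suc q) + n ^ Suc q + Suc q * Suc n ^ Suc q"
      by (simp add: algebra_simps)
    also have "\<dots> \<le> n ^ Suc (Suc q) + Suc n ^ Suc q + Suc q * Suc n ^ Suc q"
      using power_mono[of n "Suc n" "Suc q"] by linarith
    finally show ?case by simp
  qed simp
  then show ?case using Suc by (simp add: algebra_simps)
qed simp

text \<open>
  Summing over ranks, \<open>N ^ (q + 1) \<le> (q + 1) \<Sum>\<^sub>Q N\<^sub>Q ^ q\<close> pointwise, where \<open>N\<^sub>Q\<close> counts only the
  cubes below \<open>Q\<close>. The induction hypothesis bounds the integral of \<open>N\<^sub>Q ^ q\<close> by the mass of the
  cubes below \<open>Q\<close>, and the packing condition turns this back into the mass of \<open>Q\<close>, at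
  the price of one factor \<open>K\<close>.
\<close>
lemma nn_integral_overlap_power:
  assumes "finite F" "nested F" "F \<subseteq> sets M"
    and "\<And>Q. Q \<in> F \<Longrightarrow> (\<Sum>R\<in>below F Q. emeasure M R) \<le> K * emeasure M Q"
  shows "(\<integral>\<^sup>+x. of_nat (overlap F x ^ Suc q) \<partial>M) \<le> of_nat (fact (Suc q)) * K ^ q * (\<Sum>Q\<in>F. emeasure M Q)"
  using assms
proof (induction q arbitrary: F)
  case 0
  have "(\<integral>\<^sup>+x. of_nat (overlap F x) \<partial>M) = (\<Sum>Q\<in>F. emeasure M Q)"
    using 0(1,3) by (simp add: of_nat_overlap_eq nn_integral_sum subset_eq cong: sum.cong)
  then show ?case by simp
next
  case (Suc q)
  let ?g = "\<lambda>Q x. of_nat (overlap (below F Q) x ^ Suc q) :: ennreal"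
  have fin: "finite (below F Q)" and meas: "below F Q \<subseteq> sets M" for Q
    using finite_subset[OF below_subset Suc.prems(1)] subset_trans[OF below_subset Suc.prems(3)] .
  have [measurable]: "(\<lambda>x. overlap (below F Q) x) \<in> measurable M (count_space UNIV)" for Q
    by (rule measurable_overlap[OF fin meas])
  have pw: "of_nat (overlap F x ^ Suc (Suc q)) \<le> of_nat (Suc (Suc q)) * (\<Sum>Q\<in>F. ?g Q x)" for x
  proof -
    have "(\<Sum>j = 1..overlap F x. j ^ Suc q) = (\<Sum>Q | Q \<in> F \<and> x \<in> Q. overlap (below F Q) x ^ Suc q)"
      by (rule sum.reindex_bij_betw[OF bij_betw_overlap_below[OF Suc.prems(1,2)], symmetric])
    also have "\<dots> \<le> (\<Sum>Q\<in>F. overlap (below F Q) x ^ Suc q)"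
      using Suc.prems(1) by (intro sum_mono2) auto
    finally have "overlap F x ^ Suc (Suc q) \<le> Suc (Suc q) * (\<Sum>Q\<in>F. overlap (below F Q) x ^ Suc q)"
      using power_Suc_le_sum_powers[of "overlap F x" "Suc q"] by (meson mult_le_mono2 order_trans)
    then show ?thesis
      unfolding of_nat_sum[symmetric] of_nat_mult[symmetric] of_nat_le_iff .
  qed
  have "(\<integral>\<^sup>+x. of_nat (overlap F x ^ Suc (Suc q)) \<partial>M)
      \<le> (\<integral>\<^sup>+x. of_nat (Suc (Suc q)) * (\<Sum>Q\<in>F. ?g Q x) \<partial>M)"
    by (intro nn_integral_mono pw)
  also have "\<dots> = of_nat (Suc (Suc q)) * (\<Sum>Q\<in>F. \<integral>\<^sup>+x. ?g Q x \<partial>M)"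
    by (subst nn_integral_cmult) (auto intro!: nn_integral_sum arg_cong2[where f="(*)"])
  also have "\<dots> \<le> of_nat (Suc (Suc q)) * (\<Sum>Q\<in>F. of_nat (fact (Suc q)) * K ^ q * (K * emeasure M Q))"
  proof (intro mult_left_mono sum_mono)
    fix Q assume Q: "Q \<in> F"
    have "(\<integral>\<^sup>+x. ?g Q x \<partial>M) \<le> of_nat (fact (Suc q)) * K ^ q * (\<Sum>R\<in>below F Q. emeasure M R)"
    proof (rule Suc.IH[OF fin _ meas])
      show "nested (below F Q)" using nested_subset[OF Suc.prems(2) below_subset] .
      fix R assume R: "R \<in> below F Q"
      then show "(\<Sum>R'\<in>below (below F Q) R. emeasure M R') \<le> K * emeasure M R"
        using Suc.prems(4)[of R] below_subset[of F Q] by (auto simp: below_below)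
    qed
    also have "\<dots> \<le> of_nat (fact (Suc q)) * K ^ q * (K * emeasure M Q)"
      using Suc.prems(4)[OF Q] by (intro mult_left_mono) auto
    finally show "(\<integral>\<^sup>+x. ?g Q x \<partial>M) \<le> of_nat (fact (Suc q)) * K ^ q * (K * emeasure M Q)" .
  qed auto
  also have "\<dots> = of_nat (fact (Suc (Suc q))) * K ^ Suc q * (\<Sum>Q\<in>F. emeasure M Q)"
    unfolding sum_distrib_left[symmetric] fact_Suc[of "Suc q"] of_nat_mult power_Suc2 by (simp add: mult.assoc)
  finally show ?case .
qed

lemma emeasure_overlap_gt:
  assumes "finite F" "nested F" "F \<subseteq> sets M"
    and "\<And>Q. Q \<in> F \<Longrightarrow> (\<Sum>R\<in>below F Q. emeasure M R) \<le> K * emeasure M Q"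
    and "l > 0"
  shows "emeasure M {x \<in> space M. real (overlap F x) > l}
     \<le> ennreal (fact (Suc q) * l powr - real (Suc q)) * K ^ q * (\<Sum>Q\<in>F. emeasure M Q)"
proof -
  let ?u = "\<lambda>x. of_nat (overlap F x ^ Suc q) :: ennreal"
  let ?c = "ennreal (l powr - real (Suc q))"
  note [measurable] = measurable_overlap[OF assms(1,3)]
  have pos: "1 \<le> ?c * ?u x" if "real (overlap F x) > l" for x
  proof -
    have "l ^ Suc q \<le> real (overlap F x ^ Suc q)"
      unfolding of_nat_power using that assms(5) by (intro power_mono) auto
    then have "1 \<le> l powr - real (Suc q) * real (overlap F x ^ Suc q)"
      using assms(5) by (simp add: powr_minus powr_realpow field_simps del: of_nat_Suc power_Suc)
    then show ?thesis
      by (metis ennreal_1 ennreal_leI ennreal_mult' ennreal_of_nat_eq_real_of_nat powr_ge_zero)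
  qed
  have "emeasure M {x \<in> space M. real (overlap F x) > l} = (\<integral>\<^sup>+x. indicator {x \<in> space M. real (overlap F x) > l} x \<partial>M)"
    by simp
  also have "\<dots> \<le> (\<integral>\<^sup>+x. ?c * ?u x \<partial>M)"
    using pos by (intro nn_integral_mono) (auto simp: indicator_def)
  also have "\<dots> = ?c * (\<integral>\<^sup>+x. ?u x \<partial>M)"
    by (intro nn_integral_cmult) simp
  also have "\<dots> \<le> ?c * (of_nat (fact (Suc q)) * K ^ q * (\<Sum>Q\<in>F. emeasure M Q))"
    by (intro mult_left_mono nn_integral_overlap_power assms) auto
  also have "?c * (of_nat (fact (Suc q)) * K ^ q * (\<Sum>Q\<in>F. emeasure M Q))
      = ennreal (fact (Suc q) * l powr - real (Suc q)) * K ^ q * (\<Sum>Q\<in>F. emeasure M Q)"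
    by (simp add: ennreal_mult' mult_ac ennreal_of_nat_eq_real_of_nat del: fact_Suc of_nat_Suc)
  finally show ?thesis .
qed

text \<open>
  The tail bound with exponent \<open>0\<close>, without decay in \<open>l\<close>: a point of positive overlap lies in
  the union of the family.
\<close>
lemma emeasure_overlap_pos:
  assumes "finite F" "F \<subseteq> sets M" "l \<ge> 0"
  shows "emeasure M {x \<in> space M. real (overlap F x) > l} \<le> (\<Sum>Q\<in>F. emeasure M Q)"
proof -
  have "{x \<in> space M. real (overlap F x) > l} \<subseteq> \<Union>F"
  proof
    fix x assume "x \<in> {x \<in> space M. real (overlap F x) > l}"
    then have "overlap F x \<noteq> 0" using assms(3) by auto
    then have "{Q \<in> F. x \<in> Q} \<noteq> {}" by (metis card.empty overlap_def)
    then show "x \<in> \<Union>F" by blast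
  qed
  then have "emeasure M {x \<in> space M. real (overlap F x) > l} \<le> emeasure M (\<Union>Q\<in>F. Q)"
    using assms by (intro emeasure_mono) auto
  also have "\<dots> \<le> (\<Sum>Q\<in>F. emeasure M Q)"
    using assms by (intro emeasure_subadditive_finite) auto
  finally show ?thesis .
qed

section \<open>Splitting a sum into dyadic levels\<close>

lemma sum_powr_abs_le:
  assumes "\<delta> > 0"
  shows "\<exists>Z > 0. \<forall>K :: int set. finite K \<longrightarrow> (\<Sum>k\<in>K. 2 powr - (\<delta> * \<bar>real_of_int k\<bar>)) \<le> (Z :: real)"
proof -
  define \<rho> :: real where "\<rho> = 2 powr - \<delta>"
  have \<rho>: "0 < \<rho>" "\<rho> < 1" using assms by (auto simp: \<rho>_def powr_less_one)
  have eq: "2 powr - (\<delta> * \<bar>real_of_int k\<bar>) = \<rho> ^ nat \<bar>k\<bar>" for k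
    by (simp add: \<rho>_def powr_powr flip: powr_realpow)
  have part: "(\<Sum>k\<in>K. \<rho> ^ nat \<bar>k\<bar>) \<le> 1 / (1 - \<rho>)" if "finite K" "inj_on (\<lambda>k. nat \<bar>k\<bar>) K" for K
  proof -
    have "(\<Sum>k\<in>K. \<rho> ^ nat \<bar>k\<bar>) = (\<Sum>n\<in>(\<lambda>k. nat \<bar>k\<bar>) ` K. \<rho> ^ n)"
      using sum.reindex[OF that(2), of "\<lambda>n. \<rho> ^ n"] by simp
    also have "\<dots> \<le> (\<Sum>n. \<rho> ^ n)"
      using that \<rho> by (intro sum_le_suminf) (auto intro: summable_geometric)
    finally show ?thesis using \<rho> by (simp add: suminf_geometric)
  qed
  have "(\<Sum>k\<in>K. \<rho> ^ nat \<bar>k\<bar>) \<le> 2 / (1 - \<rho>)" if "finite K" for K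
  proof -
    have "(\<Sum>k\<in>K. \<rho> ^ nat \<bar>k\<bar>) = (\<Sum>k\<in>K \<inter> {0..}. \<rho> ^ nat \<bar>k\<bar>) + (\<Sum>k\<in>K - {0..}. \<rho> ^ nat \<bar>k\<bar>)"
      using that by (rule sum.Int_Diff)
    also have "\<dots> \<le> 1 / (1 - \<rho>) + 1 / (1 - \<rho>)"
      using that by (intro add_mono part) (auto simp: inj_on_def)
    finally show ?thesis by simp
  qed
  moreover have "2 / (1 - \<rho>) > 0" using \<rho> by simp
  ultimately show ?thesis unfolding eq by blast
qed

text \<open>
  The level starting at \<open>L\<close>; \<open>a Q\<close> will be the average of \<open>f \<sigma>\<close> over \<open>Q\<close>.
\<close>
definition level :: "('a set \<Rightarrow> real) \<Rightarrow> 'a set set \<Rightarrow> real \<Rightarrow> 'a set set" where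
  "level a F L = {Q \<in> F. L < a Q \<and> a Q \<le> 2 * L}"

lemma dyadic_level:
  assumes "0 < L" "0 < a"
  shows "\<exists>k :: int. L * 2 powr k < a \<and> a \<le> 2 * (L * 2 powr k)"
proof -
  define k where "k = \<lceil>log 2 (a / L)\<rceil> - 1"
  have "of_int k < log 2 (a / L)" "log 2 (a / L) \<le> of_int k + 1"
    unfolding k_def by linarith+
  then have "2 powr of_int k < a / L" "a / L \<le> 2 powr (of_int k + 1)"
    using assms by (simp_all add: less_log_iff log_le_iff)
  then show ?thesis using assms by (intro exI[of _ k]) (simp add: powr_add field_simps)
qed

text \<open>
  Tail bounds with two exponents at once. Passing from exponent \<open>m\<close> to exponent \<open>n\<close>
  gains \<open>l powr (m - n)\<close> and loses \<open>W powr (n - m)\<close>, so \<open>W\<close> is the overlap at which the two bounds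
  are equally good.
\<close>
definition tail_bound :: "'a measure \<Rightarrow> 'a set set \<Rightarrow> nat \<Rightarrow> nat \<Rightarrow> real \<Rightarrow> real \<Rightarrow> bool" where
  "tail_bound M S m n B W \<longleftrightarrow>
     (\<forall>F l q. finite F \<and> F \<subseteq> S \<and> 0 < l \<and> q \<in> {m, n} \<longrightarrow>
        emeasure M {x \<in> space M. real (overlap F x) > l}
          \<le> ennreal (B * W powr (real q - real m) * l powr - real q) * (\<Sum>Q\<in>F. emeasure M Q))"

text \<open>
  The exponents \<open>m\<close> and \<open>n\<close> lie on both sides of \<open>p/r\<close>, which leaves room for the factor
  \<open>2 powr (-\<delta>|k|)\<close> in the thresholds. Owing to it the contributions of the
  levels to the sum, at points where every overlap is below its threshold, form a convergent
  series with total at most \<open>t powr r\<close>, while the measures of the exceptional sets still decay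
  geometrically in \<open>|k|\<close>.
\<close>
lemma emeasure_level_sum_le:
  fixes p r B :: real and m n :: nat
  assumes "0 < r" "real m * r < p" "p < real n * r" "0 < B"
  shows "\<exists>C > 0. \<forall>(M :: 'a measure) F a (W :: real) (X :: real) (t :: real).
    finite F \<and> F \<subseteq> sets M \<and> (\<forall>Q\<in>F. 0 \<le> a Q) \<and> 0 < W \<and> 0 \<le> X \<and> 0 < t \<and>
    (\<forall>L > 0. (\<Sum>Q\<in>level a F L. emeasure M Q) \<le> ennreal (X * L powr - p)) \<and>
    tail_bound M F m n B W \<longrightarrow>
    emeasure M {x \<in> space M. (\<Sum>Q\<in>F. a Q powr r * indicator Q x) > t powr r}
      \<le> ennreal (C * W powr (p / r - real m) * X * t powr - p)"
proof -
  \<comment> \<open>The largest value with \<open>m (r + \<delta>) + \<delta> \<le> p\<close> and \<open>p + \<delta> \<le> n (r - \<delta>)\<close>.\<close>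
  define \<delta> where "\<delta> = min ((p - m * r) / (m + 1)) ((n * r - p) / (n + 1))"
  have \<delta>: "\<delta> > 0" using assms by (simp add: \<delta>_def)
  have "\<delta> \<le> (p - m * r) / (m + 1)" "\<delta> \<le> (n * r - p) / (n + 1)"
    by (auto simp: \<delta>_def)
  then have \<delta>m: "m * (r + \<delta>) + \<delta> \<le> p" and \<delta>n: "p + \<delta> \<le> n * (r - \<delta>)"
    by (auto simp: field_simps)
  obtain Z :: real where Z: "Z > 0" "\<And>K :: int set. finite K \<Longrightarrow> (\<Sum>k\<in>K. 2 powr - (\<delta> * \<bar>real_of_int k\<bar>)) \<le> Z"
    using sum_powr_abs_le[OF \<delta>] by blast
  \<comment> \<open>The factor \<open>2 powr -r\<close> pays for rounding the averages of a level up to \<open>2 L\<close>.\<close>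
  define c where "c = 2 powr - r / Z"
  have c: "c > 0" using Z by (simp add: c_def)
  define C where "C = B * max (c powr - real m) (c powr - real n) * Z"
  have C: "C > 0" using assms(4) Z c by (simp add: C_def less_max_iff_disj)
  show ?thesis
  proof (intro exI[of _ C] conjI allI impI C; elim conjE)
    fix M :: "'a measure" and F a and W X t :: real
    assume F: "finite F" "F \<subseteq> sets M" and a: "\<forall>Q\<in>F. (0::real) \<le> a Q" and pos: "0 < W" "(0::real) \<le> X" "0 < t"
      and H1: "\<forall>L > 0. (\<Sum>Q\<in>level a F L. emeasure M Q) \<le> ennreal (X * L powr - p)"
      and tail: "tail_bound M F m n B W"
    define L where "L k = t * W powr (- (1 / r)) * 2 powr real_of_int k" for k
    define l where "l k = c * W * 2 powr - (r * k) * 2 powr - (\<delta> * \<bar>real_of_int k\<bar>)" for k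
    define E where "E k = {x \<in> space M. real (overlap (level a F (L k)) x) > l k}" for k
    have Lpos: "L k > 0" and lpos: "l k > 0" for k using pos c by (auto simp: L_def l_def)
    have L_powr: "L k powr s = t powr s * W powr - (s / r) * 2 powr (s * k)" for k s
      using pos by (simp add: L_def powr_mult powr_powr mult_ac)
    have fin: "finite (level a F s)" "level a F s \<subseteq> sets M" for s
      using F by (auto simp: level_def)
    have Emeas: "E k \<in> sets M" for k
    proof -
      note [measurable] = measurable_overlap[OF fin]
      show ?thesis unfolding E_def by measurable
    qed
    have Ebound: "emeasure M (E k) \<le> ennreal (C / Z * W powr (p / r - real m) * X * t powr - p * 2 powr - (\<delta> * \<bar>real_of_int k\<bar>))" for k
    proof -
      \<comment> \<open>For large averages (\<open>k \<ge> 0\<close>) the thresholds are small, and the lower exponent is the better one.\<close>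
      define q where "q = (if k \<ge> 0 then m else n)"
      have "emeasure M (E k) \<le> ennreal (B * W powr (real q - real m) * l k powr - real q)
            * (\<Sum>Q\<in>level a F (L k). emeasure M Q)"
        unfolding E_def using tail[unfolded tail_bound_def, rule_format, of "level a F (L k)" "l k" q] fin lpos[of k]
        by (simp add: q_def level_def)
      also have "\<dots> \<le> ennreal (B * W powr (real q - real m) * l k powr - real q) * ennreal (X * L k powr - p)"
        using H1 Lpos by (intro mult_left_mono) auto
      also have "\<dots> = ennreal (B * W powr (real q - real m) * l k powr - real q * (X * L k powr - p))"
        using assms(4) pos by (simp add: ennreal_mult')
      also have "B * W powr (real q - real m) * l k powr - real q * (X * L k powr - p) =
         (B * c powr - real q) * (W powr (real q - real m) * W powr - real q * W powr (p / r)) * X * t powr - p *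
          (2 powr (r * k * q) * 2 powr (\<delta> * \<bar>real_of_int k\<bar> * q) * 2 powr - (p * k))"
        unfolding L_powr unfolding l_def using pos c by (simp add: powr_mult powr_powr mult_ac)
      also have "W powr (real q - real m) * W powr - real q * W powr (p / r) = W powr (p / r - real m)"
        using pos by (simp add: flip: powr_add)
      also have "2 powr (r * k * q) * 2 powr (\<delta> * \<bar>real_of_int k\<bar> * q) * 2 powr - (p * k)
          = (2 :: real) powr (r * k * q + \<delta> * \<bar>real_of_int k\<bar> * q - p * k)"
        by (simp add: powr_add powr_diff powr_minus field_simps)
      also have "ennreal (B * c powr - real q * W powr (p / r - real m) * X * t powr - p * 2 powr (r * k * q + \<delta> * \<bar>real_of_int k\<bar> * q - p * k))
         \<le> ennreal (C / Z * W powr (p / r - real m) * X * t powr - p * 2 powr - (\<delta> * \<bar>real_of_int k\<bar>))"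
      proof (intro ennreal_leI mult_mono)
        show "B * c powr - real q \<le> C / Z" using assms(4) Z by (simp add: C_def q_def)
        have "r * k * q + \<delta> * \<bar>real_of_int k\<bar> * q - p * k \<le> - (\<delta> * \<bar>real_of_int k\<bar>)"
        proof (cases "k \<ge> 0")
          case True
          then show ?thesis using mult_right_mono[OF \<delta>m, of "real_of_int k"]
            by (simp add: q_def algebra_simps)
        next
          case False
          then show ?thesis using mult_right_mono[OF \<delta>n, of "- real_of_int k"]
            by (simp add: q_def algebra_simps)
        qed
        then show "2 powr (r * k * q + \<delta> * \<bar>real_of_int k\<bar> * q - p * k) \<le> (2 :: real) powr - (\<delta> * \<bar>real_of_int k\<bar>)"
          by (intro powr_mono) auto
      qed (use pos assms(4) Z C in auto)
      finally show ?thesis .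
    qed
    define F' where "F' = {Q \<in> F. a Q > 0}"
    have "\<exists>\<kappa>. \<forall>Q\<in>F'. Q \<in> level a F (L (\<kappa> Q))"
    proof (intro bchoice ballI)
      fix Q assume Q: "Q \<in> F'"
      have "t * W powr (- (1 / r)) > 0" using pos by simp
      from dyadic_level[OF this, of "a Q"] Q
      show "\<exists>k. Q \<in> level a F (L k)" by (auto simp: level_def L_def F'_def)
    qed
    then obtain \<kappa> where \<kappa>: "\<And>Q. Q \<in> F' \<Longrightarrow> Q \<in> level a F (L (\<kappa> Q))" by blast
    define K where "K = \<kappa> ` F'"
    have finF': "finite F'" and finK: "finite K" using F by (auto simp: F'_def K_def)
    \<comment> \<open>Off the sets \<open>E k\<close> every overlap is at most its threshold, so level \<open>k\<close> contributes at most \<open>t powr r * 2 powr (-\<delta>|k|) / Z\<close>.\<close>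
    have sub: "{x \<in> space M. (\<Sum>Q\<in>F. a Q powr r * indicator Q x) > t powr r} \<subseteq> (\<Union>k\<in>K. E k)"
    proof (rule subsetI, rule ccontr)
      fix x assume x: "x \<in> {x \<in> space M. (\<Sum>Q\<in>F. a Q powr r * indicator Q x) > t powr r}" "x \<notin> (\<Union>k\<in>K. E k)"
      have "(\<Sum>Q\<in>F. a Q powr r * indicator Q x) = (\<Sum>Q\<in>F'. a Q powr r * indicator Q x)"
        using F a by (intro sum.mono_neutral_right) (auto simp: F'_def)
      also have "\<dots> = (\<Sum>k\<in>K. \<Sum>Q | Q \<in> F' \<and> \<kappa> Q = k. a Q powr r * indicator Q x)"
        unfolding K_def by (rule sum.image_gen[OF finF'])
      also have "\<dots> \<le> (\<Sum>k\<in>K. t powr r * 2 powr r * c * 2 powr - (\<delta> * \<bar>real_of_int k\<bar>))"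
      proof (rule sum_mono)
        fix k assume k: "k \<in> K"
        have "(\<Sum>Q | Q \<in> F' \<and> \<kappa> Q = k. a Q powr r * indicator Q x) \<le> (\<Sum>Q | Q \<in> F' \<and> \<kappa> Q = k. (2 * L k) powr r * indicator Q x)"
          using \<kappa> assms(1) by (intro sum_mono mult_right_mono powr_mono2) (auto simp: level_def F'_def)
        also have "\<dots> \<le> (\<Sum>Q\<in>level a F (L k). (2 * L k) powr r * indicator Q x)"
          using \<kappa> fin by (intro sum_mono2) auto
        also have "\<dots> = (2 * L k) powr r * real (overlap (level a F (L k)) x)"
          by (simp add: of_nat_overlap_eq fin sum_distrib_left)
        also have "\<dots> \<le> (2 * L k) powr r * l k"
          using x k by (intro mult_left_mono) (auto simp: E_def not_less)
        also have "\<dots> = t powr r * 2 powr r * c * (W powr -1 * W) * (2 powr (r * k) * 2 powr - (r * k)) * 2 powr - (\<delta> * \<bar>real_of_int k\<bar>)"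
          using pos assms(1) Lpos[of k] by (simp add: powr_mult L_powr l_def)
        also have "W powr -1 * W = 1" using pos by (simp add: powr_minus)
        also have "2 powr (r * k) * 2 powr - (r * k) = (1 :: real)" by (simp flip: powr_add)
        finally show "(\<Sum>Q | Q \<in> F' \<and> \<kappa> Q = k. a Q powr r * indicator Q x) \<le> t powr r * 2 powr r * c * 2 powr - (\<delta> * \<bar>real_of_int k\<bar>)"
          by simp
      qed
      also have "\<dots> = t powr r * 2 powr r * c * (\<Sum>k\<in>K. 2 powr - (\<delta> * \<bar>real_of_int k\<bar>))"
        by (simp add: sum_distrib_left)
      also have "\<dots> \<le> t powr r * 2 powr r * c * Z"
        using Z(2)[OF finK] c by (intro mult_left_mono) auto
      also have "\<dots> = t powr r" using Z by (simp add: c_def powr_minus)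
      finally show False using x by auto
    qed
    have "emeasure M {x \<in> space M. (\<Sum>Q\<in>F. a Q powr r * indicator Q x) > t powr r} \<le> emeasure M (\<Union>k\<in>K. E k)"
      using sub finK Emeas by (intro emeasure_mono) auto
    also have "\<dots> \<le> (\<Sum>k\<in>K. emeasure M (E k))"
      using finK Emeas by (intro emeasure_subadditive_finite) auto
    also have "\<dots> \<le> (\<Sum>k\<in>K. ennreal (C / Z * W powr (p / r - real m) * X * t powr - p * 2 powr - (\<delta> * \<bar>real_of_int k\<bar>)))"
      by (intro sum_mono Ebound)
    also have "\<dots> = ennreal (\<Sum>k\<in>K. C / Z * W powr (p / r - real m) * X * t powr - p * 2 powr - (\<delta> * \<bar>real_of_int k\<bar>))"
      using C Z pos by (intro sum_ennreal) auto
    also have "\<dots> = ennreal (C / Z * W powr (p / r - real m) * X * t powr - p * (\<Sum>k\<in>K. 2 powr - (\<delta> * \<bar>real_of_int k\<bar>)))"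
      by (simp add: sum_distrib_left)
    also have "\<dots> \<le> ennreal (C / Z * W powr (p / r - real m) * X * t powr - p * Z)"
      using Z(1) Z(2)[OF finK] C pos by (intro ennreal_leI mult_left_mono) auto
    also have "\<dots> = ennreal (C * W powr (p / r - real m) * X * t powr - p)"
      using Z by (simp add: field_simps)
    finally show "emeasure M {x \<in> space M. (\<Sum>Q\<in>F. a Q powr r * indicator Q x) > t powr r}
      \<le> ennreal (C * W powr (p / r - real m) * X * t powr - p)" .
  qed
qed

section \<open>The part of a cube with few cubes below it\<close>

definition shallow :: "nat \<Rightarrow> 'a set set \<Rightarrow> 'a set \<Rightarrow> 'a set" where
  "shallow k F Q = {x \<in> Q. overlap (below F Q) x \<le> k}"

lemma shallow_subset: "shallow k F Q \<subseteq> Q"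
  by (auto simp: shallow_def)

lemma shallow_measurable:
  assumes "finite F" "F \<subseteq> sets M" "Q \<in> F"
  shows "shallow k F Q \<in> sets M"
proof -
  note [measurable] = measurable_overlap[OF finite_subset[OF below_subset assms(1)] subset_trans[OF below_subset assms(2)]]
  have Q: "Q \<in> sets M" using assms by blast
  have "shallow k F Q = Q \<inter> {x \<in> space M. overlap (below F Q) x \<le> k}"
    using sets.sets_into_space[OF Q] by (auto simp: shallow_def)
  also have "\<dots> \<in> sets M" using Q by measurable
  finally show ?thesis .
qed

text \<open>
  Under the packing condition the overlap of the cubes below \<open>Q\<close> has mean at most \<open>k\<close> on \<open>Q\<close>, so
  by the Markov inequality it exceeds \<open>2 k\<close> on at most half of \<open>Q\<close>.
\<close>
lemma emeasure_le_shallow: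
  assumes "finite F" "nested F" "F \<subseteq> sets M" "Q \<in> F" "emeasure M Q < \<infinity>" "0 < k"
    and "\<And>Q. Q \<in> F \<Longrightarrow> (\<Sum>R\<in>below F Q. emeasure M R) \<le> of_nat k * emeasure M Q"
  shows "emeasure M Q \<le> 2 * emeasure M (shallow (2 * k) F Q)"
proof -
  let ?G = "below F Q" and ?s = "shallow (2 * k) F Q"
  have fin: "finite ?G" and nest: "nested ?G" and meas: "?G \<subseteq> sets M"
    using finite_subset[OF below_subset assms(1)] nested_subset[OF assms(2) below_subset]
      subset_trans[OF below_subset assms(3)] .
  note [measurable] = measurable_overlap[OF fin meas]
  let ?d = "{x \<in> space M. real (overlap ?G x) > real (2 * k)}"
  have Q: "Q \<in> sets M" and s: "?s \<in> sets M"
    using assms(3,4) shallow_measurable[OF assms(1,3,4)] by auto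
  have d: "?d \<in> sets M" by measurable
  have "emeasure M ?d \<le> ennreal (fact (Suc 0) * real (2 * k) powr - real (Suc 0)) * of_nat k ^ 0 * (\<Sum>R\<in>?G. emeasure M R)"
  proof (rule emeasure_overlap_gt[OF fin nest meas])
    fix R assume "R \<in> ?G"
    then show "(\<Sum>R'\<in>below ?G R. emeasure M R') \<le> of_nat k * emeasure M R"
      using assms(7)[of R] below_subset[of F Q] by (auto simp: below_below)
  qed (use assms(6) in simp)
  also have "\<dots> \<le> ennreal (1 / real (2 * k)) * (of_nat k * emeasure M Q)"
    using assms(6) assms(7)[OF assms(4)] by (simp add: powr_minus_divide mult_left_mono)
  also have "\<dots> = ennreal (1 / 2) * emeasure M Q"
    using assms(6) by (simp add: mult.assoc[symmetric] ennreal_of_nat_eq_real_of_nat ennreal_mult'[symmetric])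
  finally have d_le: "emeasure M ?d \<le> ennreal (1 / 2) * emeasure M Q" .
  have "Q \<subseteq> ?s \<union> ?d"
    using sets.sets_into_space[OF Q] by (auto simp: shallow_def)
  then have "emeasure M Q \<le> emeasure M (?s \<union> ?d)" using s d by (intro emeasure_mono) auto
  also have "\<dots> \<le> emeasure M ?s + emeasure M ?d" using s d by (rule emeasure_subadditive)
  also have "\<dots> \<le> emeasure M ?s + ennreal (1 / 2) * emeasure M Q" using d_le by (rule add_left_mono)
  finally have le: "emeasure M Q \<le> emeasure M ?s + ennreal (1 / 2) * emeasure M Q" .
  have "emeasure M ?s \<le> emeasure M Q" using shallow_subset Q by (rule emeasure_mono)
  then obtain a b where ab: "emeasure M Q = ennreal a" "emeasure M ?s = ennreal b" "0 \<le> a" "0 \<le> b"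
    using assms(5) by (metis ennreal_cases infinity_ennreal_def leD top.not_eq_extremum order.strict_trans1)
  from le have "ennreal a \<le> ennreal (b + 1 / 2 * a)"
    unfolding ab using ab(3,4) by (simp only: ennreal_mult' ennreal_plus mult_nonneg_nonneg zero_le_divide_1_iff zero_le_numeral)
  then have "a \<le> 2 * b" using ab(3,4) by (simp add: ennreal_le_iff del: ennreal_plus)
  then show ?thesis unfolding ab by (simp add: ennreal_mult'[symmetric] ennreal_leI flip: ennreal_numeral)
qed

text \<open>
  If \<open>x\<close> is in the shallow part of \<open>Q\<close>, then \<open>Q\<close> is among the \<open>k\<close> smallest cubes containing
  \<open>x\<close>.
\<close>
lemma sum_indicator_shallow_le:
  assumes "finite F" "nested F"
  shows "(\<Sum>Q\<in>F. indicator (shallow k F Q) x :: ennreal) \<le> of_nat k"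
proof -
  let ?C = "{Q \<in> F. x \<in> shallow k F Q}"
  have C: "?C \<subseteq> {Q \<in> F. x \<in> Q}" by (auto simp: shallow_def)
  note b = bij_betw_overlap_below[OF assms, of x]
  have "card ?C = card ((\<lambda>Q. overlap (below F Q) x) ` ?C)"
    using inj_on_subset[OF bij_betw_imp_inj_on[OF b] C] by (rule card_image[symmetric])
  also have "\<dots> \<le> card {1..k}"
  proof (rule card_mono)
    show "(\<lambda>Q. overlap (below F Q) x) ` ?C \<subseteq> {1..k}"
      using bij_betw_imp_surj_on[OF b] C by (force simp: shallow_def)
  qed simp
  finally have "card ?C \<le> k" by simp
  then show ?thesis
    using assms(1) by (simp add: indicator_def sum.If_cases Int_def)
qed

lemma sum_emeasure_shallow_le:
  assumes "finite F" "nested F" "F \<subseteq> sets M"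
  shows "(\<Sum>Q\<in>F. emeasure M (shallow k F Q)) \<le> of_nat k * emeasure M (space M)"
proof -
  have "(\<Sum>Q\<in>F. emeasure M (shallow k F Q)) = (\<integral>\<^sup>+x. (\<Sum>Q\<in>F. indicator (shallow k F Q) x) \<partial>M)"
    using shallow_measurable[OF assms(1,3)] by (subst nn_integral_sum) auto
  also have "\<dots> \<le> (\<integral>\<^sup>+x. of_nat k \<partial>M)"
    by (intro nn_integral_mono sum_indicator_shallow_le assms)
  finally show ?thesis by simp
qed

section \<open>Hoelder's inequality on a set\<close>

text \<open>
  The tangent inequality for the convex function \<open>u powr p\<close> at \<open>a\<close>, written with
  nonnegative terms only, so that it can be integrated in the extended nonnegative reals.
\<close>
lemma powr_ge_tangent:
  fixes a u p :: real
  assumes "1 < p" "0 \<le> a" "0 \<le> u"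
  shows "p * (a powr (p - 1) * u) \<le> u powr p + (p - 1) * a powr p"
proof -
  define q where "q = p / (p - 1)"
  have q: "q > 1" "1 / p + 1 / q = 1" "(p - 1) * q = p" using assms by (auto simp: q_def field_simps)
  have "a powr (p - 1) * u \<le> (a powr (p - 1)) powr q / q + u powr p / p"
    using Youngs_inequality[of p q u "a powr (p - 1)"] q assms by (simp add: mult_ac add_ac)
  also have "(a powr (p - 1)) powr q = a powr p" using q by (simp add: powr_powr)
  also have "a powr p / q = (p - 1) * a powr p / p" by (simp add: q_def)
  finally show ?thesis using assms by (simp add: field_simps)
qed

text \<open>
  Hoelder's inequality against the constant \<open>1\<close>, with the finiteness of the left side as
  part of the conclusion: the tangent at \<open>1\<close> gives finiteness, and the tangent at the mean value
  \<open>n / s\<close> gives the bound.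
\<close>
lemma nn_integral_powr_Holder:
  fixes f :: "'a \<Rightarrow> real"
  assumes p: "1 < p" and f: "f \<in> borel_measurable M" "\<And>x. 0 \<le> f x"
    and s: "emeasure M (space M) = ennreal s" "0 \<le> s"
    and \<phi>: "(\<integral>\<^sup>+x. ennreal (f x powr p) \<partial>M) = ennreal \<phi>" "0 \<le> \<phi>"
  shows "\<exists>n \<ge> 0. (\<integral>\<^sup>+x. ennreal (f x) \<partial>M) = ennreal n \<and> n powr p \<le> s powr (p - 1) * \<phi>"
proof -
  have tangent: "ennreal (p * a powr (p - 1)) * (\<integral>\<^sup>+x. ennreal (f x) \<partial>M) \<le> ennreal (\<phi> + (p - 1) * a powr p * s)"
    if a: "0 \<le> a" for a
  proof -
    have "ennreal (p * a powr (p - 1)) * (\<integral>\<^sup>+x. ennreal (f x) \<partial>M)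
        = (\<integral>\<^sup>+x. ennreal (p * (a powr (p - 1) * f x)) \<partial>M)"
      using p f a by (subst nn_integral_cmult[symmetric]) (auto simp: ennreal_mult'[symmetric] mult_ac)
    also have "\<dots> \<le> (\<integral>\<^sup>+x. ennreal (f x powr p) + ennreal ((p - 1) * a powr p) \<partial>M)"
      using powr_ge_tangent[OF p a f(2)] p
      by (intro nn_integral_mono) (simp add: ennreal_plus[symmetric] ennreal_leI del: ennreal_plus)
    also have "\<dots> = ennreal \<phi> + ennreal ((p - 1) * a powr p) * ennreal s"
      using f(1) by (subst nn_integral_add) (auto simp: \<phi> s)
    also have "\<dots> = ennreal (\<phi> + (p - 1) * a powr p * s)"
      using p \<phi>(2) s(2) by (simp add: ennreal_mult' ennreal_plus)
    finally show ?thesis .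
  qed
  have "(\<integral>\<^sup>+x. ennreal (f x) \<partial>M) \<noteq> \<infinity>"
    using tangent[of 1] p by (auto simp: ennreal_mult_top top_unique)
  then obtain n where n: "(\<integral>\<^sup>+x. ennreal (f x) \<partial>M) = ennreal n" "0 \<le> n"
    by (metis ennreal_cases infinity_ennreal_def)
  have ineq: "p * a powr (p - 1) * n \<le> \<phi> + (p - 1) * a powr p * s" if "0 \<le> a" for a
    using tangent[OF that] p \<phi>(2) s(2) n
    by (simp add: ennreal_mult'[symmetric] ennreal_le_iff del: ennreal_plus)
  have "n powr p \<le> s powr (p - 1) * \<phi>"
  proof (cases "s = 0")
    case True
    have "n = 0"
    proof -
      have "space M \<in> null_sets M" using s True by auto
      then have "(\<integral>\<^sup>+x. ennreal (f x) \<partial>M) = 0"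
        by (subst nn_integral_0_iff_AE) (use f in \<open>auto intro: AE_I'\<close>)
      then show ?thesis using n by simp
    qed
    then show ?thesis using \<phi>(2) by simp
  next
    case False
    with s have s0: "s > 0" by simp
    show ?thesis
    proof (cases "n = 0")
      case False
      with n have n0: "n > 0" by simp
      define a where "a = n / s"
      have a: "a > 0" using n0 s0 by (simp add: a_def)
      have "a powr (p - 1) * n = a powr p * s"
        using a s0 n0 powr_add[of a "p - 1" 1] by (simp add: a_def)
      then have "p * (a powr p * s) \<le> \<phi> + (p - 1) * (a powr p * s)"
        using ineq[of a] a by (simp add: mult.assoc)
      then have "a powr p * s \<le> \<phi>" by (simp add: algebra_simps)
      then have "s powr (p - 1) * (a powr p * s) \<le> s powr (p - 1) * \<phi>" by (intro mult_left_mono) auto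
      moreover have "s powr (p - 1) * (a powr p * s) = n powr p"
        using s0 n0 powr_add[of s "p - 1" 1] by (simp add: a_def powr_divide)
      ultimately show ?thesis by simp
    qed (use \<phi> in auto)
  qed
  with n show ?thesis by blast
qed

lemma Holder_density:
  fixes f :: "'a \<Rightarrow> real"
  assumes p: "1 < p" and f: "f \<in> borel_measurable M" "\<And>x. 0 \<le> f x"
    and A: "A \<in> sets M" "emeasure M A = ennreal s" "0 \<le> s"
    and \<phi>: "emeasure (density M (\<lambda>x. ennreal (f x powr p))) A = ennreal \<phi>" "0 \<le> \<phi>"
  shows "\<exists>n \<ge> 0. emeasure (density M (\<lambda>x. ennreal (f x))) A = ennreal n \<and> n powr p \<le> s powr (p - 1) * \<phi>"
proof -
  let ?R = "restrict_space M A"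
  have fR: "f \<in> borel_measurable ?R" using f(1) by (rule measurable_restrict_space1)
  have int: "(\<integral>\<^sup>+x. h x \<partial>?R) = emeasure (density M h) A" if "h \<in> borel_measurable M" for h
    using A(1) that by (simp add: nn_integral_restrict_space emeasure_density)
  have "emeasure ?R (space ?R) = ennreal s"
    using A sets.sets_into_space[OF A(1)] by (simp add: emeasure_restrict_space space_restrict_space Int_absorb2)
  from nn_integral_powr_Holder[OF p fR f(2) this A(3), of \<phi>] \<phi> f(1)
  show ?thesis by (simp add: int)
qed

section \<open>Dyadic cubes\<close>

text \<open>
  The default rule rewrites Lebesgue measure to Borel measure of the main part of a set, a form
  in which the facts about cubes below no longer apply.
\<close>
declare emeasure_completion [simp del]

lemma half_open_cube_facts:
  fixes a :: "real ^ 'n"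
  assumes "l > 0"
  shows "half_open_cube a l \<in> sets lebesgue" (is ?meas)
    and "0 < emeasure lebesgue (half_open_cube a l)" (is ?pos)
    and "emeasure lebesgue (half_open_cube a l) < \<infinity>" (is ?fin)
    and "bounded (half_open_cube a l)" (is ?bdd)
    and "\<exists>U. open U \<and> U \<noteq> {} \<and> U \<subseteq> half_open_cube a l" (is ?int)
proof -
  let ?b = "\<chi> i. a $ i + l"
  have lower: "box a ?b \<subseteq> half_open_cube a l" and upper: "half_open_cube a l \<subseteq> cbox a ?b"
    by (auto simp: half_open_cube_def mem_box_cart less_imp_le)
  have "half_open_cube a l = (\<Inter>i. {x. a $ i \<le> x $ i} \<inter> {x. x $ i < a $ i + l})"
    by (auto simp: half_open_cube_def)
  also have "\<dots> \<in> sets borel"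
    by (intro sets.countable_INT' sets.Int borel_closed borel_open closed_halfspace_component_ge_cart open_halfspace_component_lt_cart) auto
  finally have meas: "half_open_cube a l \<in> sets borel" .
  then show ?meas by simp
  show ?bdd using bounded_subset[OF bounded_cbox upper] .
  have ne: "box a ?b \<noteq> {}" using assms by (simp add: interval_ne_empty_cart)
  then show ?int using lower by blast
  have "\<not> negligible (box a ?b)" using ne open_not_negligible open_box by blast
  then have "emeasure lebesgue (box a ?b) \<noteq> 0" by (simp add: negligible_iff_emeasure0)
  then show ?pos
    using emeasure_mono[OF lower \<open>?meas\<close>] by (metis le_zero_eq linorder_not_less not_gr_zero)
  show ?fin
    using emeasure_mono[OF upper, of lebesgue] emeasure_lborel_cbox_finite[of a ?b]
    by (simp add: emeasure_completion order.strict_trans1)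
qed

text \<open>
  A fixed choice of the sequence of generations whose existence makes \<open>D\<close> a dyadic system.
\<close>
definition dyadic_generation :: "(real ^ 'n) set set \<Rightarrow> int \<Rightarrow> (real ^ 'n) set set" where
  "dyadic_generation D = (SOME G.
     D = (\<Union>k. G k) \<and>
     (\<forall>k. partition_on UNIV (G k)) \<and>
     (\<forall>k. \<forall>Q \<in> G k. \<exists>a. Q = half_open_cube a (2 powi (- k))) \<and>
     (\<forall>k. \<forall>Q \<in> G (k + 1). \<exists>R \<in> G k. Q \<subseteq> R))"

context
  fixes D :: "(real ^ 'n) set set"
  assumes D: "dyadic_system D"
begin

lemma dyadic_generation:
  shows mem_dyadic_iff: "Q \<in> D \<longleftrightarrow> (\<exists>k. Q \<in> dyadic_generation D k)"
    and partition_dyadic_generation: "partition_on UNIV (dyadic_generation D k)"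
    and dyadic_generation_cube: "Q \<in> dyadic_generation D k \<Longrightarrow> \<exists>a. Q = half_open_cube a (2 powi (- k))"
    and dyadic_generation_parent: "Q \<in> dyadic_generation D (k + 1) \<Longrightarrow> \<exists>R \<in> dyadic_generation D k. Q \<subseteq> R"
proof -
  let ?G = "dyadic_generation D"
  have G: "D = (\<Union>k. ?G k) \<and> (\<forall>k. partition_on UNIV (?G k)) \<and>
     (\<forall>k. \<forall>Q \<in> ?G k. \<exists>a. Q = half_open_cube a (2 powi (- k))) \<and>
     (\<forall>k. \<forall>Q \<in> ?G (k + 1). \<exists>R \<in> ?G k. Q \<subseteq> R)"
    by (rule someI_ex[OF D[unfolded dyadic_system_def], folded dyadic_generation_def])
  from G[THEN conjunct1] show "Q \<in> D \<longleftrightarrow> (\<exists>k. Q \<in> ?G k)"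
    by (metis UN_iff UNIV_I)
  from G[THEN conjunct2] show "partition_on UNIV (?G k)"
    "Q \<in> ?G k \<Longrightarrow> \<exists>a. Q = half_open_cube a (2 powi (- k))"
    "Q \<in> ?G (k + 1) \<Longrightarrow> \<exists>R \<in> ?G k. Q \<subseteq> R"
    by blast+
qed

lemma dyadic_cube_obtain:
  assumes "Q \<in> D"
  obtains a :: "real ^ 'n" and l where "0 < l" "Q = half_open_cube a l"
proof -
  let ?G = "dyadic_generation D"
  note G = dyadic_generation
  obtain k where "Q \<in> ?G k" using assms G(1) by blast
  then obtain a where "Q = half_open_cube a (2 powi (- k))" using G(3) by blast
  then show thesis by (rule that[rotated]) simp
qed

lemma dyadic_cube:
  assumes "Q \<in> D"
  shows "Q \<in> sets lebesgue" "0 < emeasure lebesgue Q" "emeasure lebesgue Q < \<infinity>" "bounded Q"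
    "\<exists>U. open U \<and> U \<noteq> {} \<and> U \<subseteq> Q"
proof -
  obtain a :: "real ^ 'n" and l where "0 < l" "Q = half_open_cube a l"
    using assms by (rule dyadic_cube_obtain)
  then show "Q \<in> sets lebesgue" "0 < emeasure lebesgue Q" "emeasure lebesgue Q < \<infinity>" "bounded Q"
    "\<exists>U. open U \<and> U \<noteq> {} \<and> U \<subseteq> Q"
    using half_open_cube_facts[of l a] by simp_all
qed

lemma dyadic_nonempty: "D \<noteq> {}"
proof -
  let ?G = "dyadic_generation D"
  note G = dyadic_generation
  have "\<Union> (?G 0) = UNIV" using G(2)[of 0] by (auto simp: partition_on_def)
  then have "?G 0 \<noteq> {}" by auto
  then show ?thesis using G(1) by blast
qed

text \<open>
  Repeatedly passing to parents moves the cube of the finer generation into a cube of the coarser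
  one, and the latter is equal to or disjoint from the other cube.
\<close>
lemma nested_dyadic: "nested D"
  unfolding nested_def
proof (intro ballI)
  let ?G = "dyadic_generation D"
  note G = dyadic_generation
  have up: "\<exists>R \<in> ?G (k - int n). Q \<subseteq> R" if "Q \<in> ?G k" for k n Q
  proof (induction n)
    case 0
    then show ?case using that by auto
  next
    case (Suc n)
    then obtain R where R: "R \<in> ?G (k - int (Suc n) + 1)" "Q \<subseteq> R" by (auto simp: algebra_simps)
    from G(4)[OF R(1)] R(2) show ?case by blast
  qed
  have le: "A \<subseteq> B \<or> A \<inter> B = {}" if AB: "A \<in> ?G k" "B \<in> ?G j" "j \<le> k" for A B j k
  proof -
    obtain R where R: "R \<in> ?G j" "A \<subseteq> R" using up[OF AB(1), of "nat (k - j)"] AB(3) by auto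
    then have "R = B \<or> R \<inter> B = {}"
      using G(2)[of j] AB(2) unfolding partition_on_def disjoint_def by blast
    with R(2) show ?thesis by blast
  qed
  fix A B assume "A \<in> D" "B \<in> D"
  then obtain j k where "A \<in> ?G j" "B \<in> ?G k" using G(1) by blast
  then show "A \<subseteq> B \<or> B \<subseteq> A \<or> A \<inter> B = {}"
    using le[of A j B k] le[of B k A j] by (cases "j \<le> k") auto
qed

lemma countable_dyadic: "countable D"
proof -
  let ?G = "dyadic_generation D"
  note G = dyadic_generation
  have "countable (?G k)" for k
  proof -
    have "\<exists>U. \<forall>Q\<in>?G k. open (U Q) \<and> U Q \<noteq> {} \<and> U Q \<subseteq> Q"
      using dyadic_cube(5) G(1) by (intro bchoice) blast
    then obtain U where U: "\<And>Q. Q \<in> ?G k \<Longrightarrow> open (U Q) \<and> U Q \<noteq> {} \<and> U Q \<subseteq> Q" by blast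
    have dis: "Q = R" if "Q \<in> ?G k" "R \<in> ?G k" "Q \<inter> R \<noteq> {}" for Q R
      using G(2)[of k] that unfolding partition_on_def disjoint_def by blast
    have "inj_on U (?G k)"
    proof (rule inj_onI)
      fix Q R assume *: "Q \<in> ?G k" "R \<in> ?G k" "U Q = U R"
      then have "Q \<inter> R \<noteq> {}" using U[of Q] U[of R] by auto
      then show "Q = R" using dis * by blast
    qed
    moreover have "countable (U ` ?G k)"
    proof (rule countable_disjoint_open_subsets)
      show "open S" if "S \<in> U ` ?G k" for S using that U by blast
      show "disjoint (U ` ?G k)"
      proof (rule disjointI)
        fix A B assume "A \<in> U ` ?G k" "B \<in> U ` ?G k" "A \<noteq> B"
        then obtain Q R where QR: "Q \<in> ?G k" "R \<in> ?G k" "A = U Q" "B = U R" "Q \<noteq> R" by blast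
        then have "Q \<inter> R = {}" using dis by blast
        then show "A \<inter> B = {}" using U[OF QR(1)] U[OF QR(2)] QR(3,4) by blast
      qed
    qed
    ultimately show ?thesis using countable_image_inj_on by blast
  qed
  moreover have "D = (\<Union>k. ?G k)" using G(1) by blast
  ultimately show ?thesis using countable_UN[OF countableI_type, of UNIV ?G] by metis
qed

end

section \<open>Weights\<close>

lemma sets_weight_measure [simp, measurable_cong]: "sets (weight_measure w) = sets lebesgue"
  and space_weight_measure [simp]: "space (weight_measure w) = UNIV"
  by (simp_all add: weight_measure_def)

lemma weight_set_integrable:
  fixes w :: "real ^ 'n \<Rightarrow> real"
  assumes "weight w"
  shows "set_integrable lebesgue (cball 0 k) w"
  using assms compact_cball unfolding weight_def by blast

lemma weight_measurable:
  fixes w :: "real ^ 'n \<Rightarrow> real"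
  assumes "weight w"
  shows "w \<in> borel_measurable lebesgue"
proof (rule borel_measurable_LIMSEQ_real)
  fix k :: nat
  show "(\<lambda>x. indicator (cball 0 (real k)) x * w x) \<in> borel_measurable lebesgue"
    using borel_measurable_integrable[OF weight_set_integrable[OF assms, of "real k", unfolded set_integrable_def]]
    by simp
next
  fix x :: "real ^ 'n"
  have "\<forall>\<^sub>F k in sequentially. indicator (cball 0 (real k)) x * w x = w x"
    using eventually_ge_at_top[of "nat \<lceil>norm x\<rceil>"]
  proof eventually_elim
    case (elim k)
    then have "norm x \<le> real k" by linarith
    then show ?case by simp
  qed
  then show "(\<lambda>k. indicator (cball 0 (real k)) x * w x) \<longlonglongrightarrow> w x"
    by (rule tendsto_eventually)
qed

lemma emeasure_weight_measure:
  assumes "weight w" "A \<in> sets lebesgue"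
  shows "emeasure (weight_measure w) A = (\<integral>\<^sup>+x\<in>A. ennreal (w x) \<partial>lebesgue)"
  using assms(2) weight_measurable[OF assms(1)] unfolding weight_measure_def
  by (intro emeasure_density) auto

lemma emeasure_weight_measure_finite:
  fixes w :: "real ^ 'n \<Rightarrow> real"
  assumes "weight w" "bounded A" "A \<in> sets lebesgue"
  shows "emeasure (weight_measure w) A < \<infinity>"
proof -
  obtain k where "\<forall>x\<in>A. norm x \<le> k" using assms(2) unfolding bounded_iff by blast
  then have k: "A \<subseteq> cball 0 k" by auto
  have "integrable lebesgue (\<lambda>x. indicator (cball 0 k) x *\<^sub>R w x)"
    using weight_set_integrable[OF assms(1)] unfolding set_integrable_def .
  then have "(\<integral>\<^sup>+x. ennreal (norm (indicator (cball 0 k) x *\<^sub>R w x)) \<partial>lebesgue) < \<infinity>"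
    by (simp add: integrable_iff_bounded)
  moreover have "emeasure (weight_measure w) A \<le> (\<integral>\<^sup>+x. ennreal (norm (indicator (cball 0 k) x *\<^sub>R w x)) \<partial>lebesgue)"
    unfolding emeasure_weight_measure[OF assms(1,3)]
    using k by (intro nn_integral_mono) (auto simp: indicator_def intro!: ennreal_leI)
  ultimately show ?thesis by simp
qed

lemma emeasure_weight_measure_pos:
  assumes "weight w" "A \<in> sets lebesgue" "0 < emeasure lebesgue A"
  shows "0 < emeasure (weight_measure w) A"
proof (rule ccontr)
  assume "\<not> 0 < emeasure (weight_measure w) A"
  then have "(\<integral>\<^sup>+x\<in>A. ennreal (w x) \<partial>lebesgue) = 0"
    using emeasure_weight_measure[OF assms(1,2)] by simp
  then have "AE x in lebesgue. ennreal (w x) * indicator A x = 0"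
    using weight_measurable[OF assms(1)] assms(2) by (subst (asm) nn_integral_0_iff_AE) auto
  moreover have "AE x in lebesgue. 0 < w x" using assms(1) by (simp add: weight_def)
  ultimately have "AE x in lebesgue. x \<notin> A"
    by eventually_elim (auto simp: indicator_def ennreal_eq_0_iff split: if_splits)
  then have "emeasure lebesgue A = 0"
    using assms(2) by (subst (asm) AE_iff_measurable[of A]) auto
  with assms(3) show False by simp
qed

lemma average_weight:
  assumes "weight w" "Q \<in> sets lebesgue"
  shows "average w Q = emeasure (weight_measure w) Q / emeasure lebesgue Q"
  by (simp add: average_def emeasure_weight_measure assms)

section \<open>Packing of sparse families\<close>

lemma ennreal_divide_le_imp_le_mult:
  fixes a b c :: ennreal
  assumes "a / c \<le> b" "0 < c" "c < \<infinity>"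
  shows "a \<le> b * c"
proof -
  have "a = a / c * c" using assms by (simp add: ennreal_divide_times ennreal_divide_self)
  also have "\<dots> \<le> b * c" using assms(1) by (rule mult_right_mono) simp
  finally show ?thesis .
qed

text \<open>
  Both packing conditions come from here: each \<open>R\<close> is replaced by its large subset \<open>E R\<close>, and as
  these subsets are disjoint, the sum is dominated by any common majorant \<open>g\<close> of the coefficients.
  The majorant is \<open>1\<close> on \<open>Q\<close> for Lebesgue measure and a maximal function for \<open>w\<close>.
\<close>
lemma sparse_carleson:
  fixes F :: "'b set set" and c :: "'b set \<Rightarrow> ennreal"
  assumes F: "finite F" and E: "disjoint_family_on E F"
    "\<And>R. R \<in> F \<Longrightarrow> E R \<in> sets M \<and> E R \<subseteq> R \<and> emeasure M R / 2 \<le> emeasure M (E R)"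
    and g: "\<And>R x. R \<in> F \<Longrightarrow> x \<in> R \<Longrightarrow> c R \<le> g x"
  shows "(\<Sum>R\<in>F. c R * emeasure M R) \<le> 2 * (\<integral>\<^sup>+x. g x \<partial>M)"
proof -
  have "(\<Sum>R\<in>F. c R * emeasure M R) \<le> (\<Sum>R\<in>F. 2 * (c R * emeasure M (E R)))"
  proof (rule sum_mono)
    fix R assume R: "R \<in> F"
    have "emeasure M R \<le> emeasure M (E R) * 2"
      using E(2)[OF R] by (intro ennreal_divide_le_imp_le_mult) auto
    then have "c R * emeasure M R \<le> c R * (emeasure M (E R) * 2)" by (intro mult_left_mono) auto
    then show "c R * emeasure M R \<le> 2 * (c R * emeasure M (E R))" by (simp add: mult_ac)
  qed
  also have "\<dots> = 2 * (\<Sum>R\<in>F. c R * emeasure M (E R))"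
    by (rule sum_distrib_left[symmetric])
  also have "(\<Sum>R\<in>F. c R * emeasure M (E R)) = (\<integral>\<^sup>+x. (\<Sum>R\<in>F. c R * indicator (E R) x) \<partial>M)"
    using E(2) by (subst nn_integral_sum) (auto simp: nn_integral_cmult_indicator intro!: borel_measurable_times_ennreal borel_measurable_indicator)
  also have "\<dots> \<le> (\<integral>\<^sup>+x. g x \<partial>M)"
  proof (rule nn_integral_mono)
    fix x
    show "(\<Sum>R\<in>F. c R * indicator (E R) x) \<le> g x"
    proof (cases "\<exists>R\<in>F. x \<in> E R")
      case True
      then obtain R where R: "R \<in> F" "x \<in> E R" by blast
      have "(\<Sum>R\<in>F. c R * indicator (E R) x) = (\<Sum>R'\<in>{R}. c R' * indicator (E R') x)"
        using R F E(1) by (intro sum.mono_neutral_right) (auto simp: disjoint_family_on_def indicator_def)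
      also have "\<dots> \<le> g x" using R E(2)[OF R(1)] g[of R x] by auto
      finally show ?thesis .
    qed (auto simp: indicator_def)
  qed
  finally show ?thesis by (simp add: mult_left_mono)
qed

lemma carleson_lebesgue:
  assumes "finite F" "F \<subseteq> S" "sparse_family S" "Q \<in> sets lebesgue"
  shows "(\<Sum>R\<in>below F Q. emeasure lebesgue R) \<le> 2 * emeasure lebesgue Q"
proof -
  obtain E where E: "disjoint_family_on E S"
    "\<And>R. R \<in> S \<Longrightarrow> E R \<in> sets lebesgue \<and> E R \<subseteq> R \<and> emeasure lebesgue R / 2 \<le> emeasure lebesgue (E R)"
    using assms(3) unfolding sparse_family_def by blast
  have "(\<Sum>R\<in>below F Q. 1 * emeasure lebesgue R) \<le> 2 * (\<integral>\<^sup>+x. indicator Q x \<partial>lebesgue)"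
  proof (rule sparse_carleson)
    show "finite (below F Q)" using finite_subset[OF below_subset assms(1)] .
    show "disjoint_family_on E (below F Q)"
      using E(1) below_subset[of F Q] assms(2) by (auto simp: disjoint_family_on_def)
  qed (use E(2) assms(2) in \<open>auto simp: below_def\<close>)
  then show ?thesis using assms(4) by simp
qed

text \<open>
  For \<open>R \<subseteq> Q\<close> the average of \<open>w\<close> over \<open>R\<close> is a lower bound on \<open>R\<close> for the maximal function of
  \<open>w\<close> restricted to \<open>Q\<close>, whose integral over \<open>Q\<close> is controlled by the \<open>A\<^sub>\<infinity>\<close> characteristic.
\<close>
lemma carleson_weight:
  assumes "dyadic_system D" "weight w" "S \<subseteq> D" "sparse_family S" "finite F" "F \<subseteq> S" "Q \<in> D"
  shows "(\<Sum>R\<in>below F Q. emeasure (weight_measure w) R) \<le> 2 * Ainf_char D w * emeasure (weight_measure w) Q"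
proof -
  let ?M = "dyadic_maximal D (\<lambda>y. indicator Q y * w y)"
  obtain E where E: "disjoint_family_on E S"
    "\<And>R. R \<in> S \<Longrightarrow> E R \<in> sets lebesgue \<and> E R \<subseteq> R \<and> emeasure lebesgue R / 2 \<le> emeasure lebesgue (E R)"
    using assms(4) unfolding sparse_family_def by blast
  have sub: "R \<in> S" "R \<in> D" "R \<subseteq> Q" if "R \<in> below F Q" for R
    using that assms(3,6) by (auto simp: below_def)
  note Q = dyadic_cube[OF assms(1,7)]
  have "(\<Sum>R\<in>below F Q. emeasure (weight_measure w) R) = (\<Sum>R\<in>below F Q. average w R * emeasure lebesgue R)"
  proof (rule sum.cong)
    fix R assume "R \<in> below F Q"
    note R = dyadic_cube[OF assms(1) sub(2)[OF this]]
    show "emeasure (weight_measure w) R = average w R * emeasure lebesgue R"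
      using R assms(2) by (simp add: average_weight ennreal_divide_times ennreal_divide_self)
  qed simp
  also have "\<dots> \<le> 2 * (\<integral>\<^sup>+x. ?M x * indicator Q x \<partial>lebesgue)"
  proof (rule sparse_carleson)
    show "finite (below F Q)" using finite_subset[OF below_subset assms(5)] .
    show "disjoint_family_on E (below F Q)"
      using E(1) sub(1) by (auto simp: disjoint_family_on_def)
    fix R x assume R: "R \<in> below F Q" "x \<in> R"
    have "average w R \<le> average (\<lambda>y. \<bar>indicator Q y * w y\<bar>) R"
      unfolding average_def using sub[OF R(1)]
      by (intro divide_right_mono_ennreal nn_integral_mono) (auto simp: indicator_def intro!: ennreal_leI)
    also have "\<dots> = average (\<lambda>y. \<bar>indicator Q y * w y\<bar>) R * indicator R x" using R by simp
    also have "\<dots> \<le> ?M x" unfolding dyadic_maximal_def using sub[OF R(1)] by (intro SUP_upper)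
    finally show "average w R \<le> ?M x * indicator Q x" using sub[OF R(1)] R(2) by auto
  qed (use E(2) sub in auto)
  also have "(\<integral>\<^sup>+x. ?M x * indicator Q x \<partial>lebesgue) \<le> Ainf_char D w * emeasure (weight_measure w) Q"
  proof (rule ennreal_divide_le_imp_le_mult)
    show "(\<integral>\<^sup>+x\<in>Q. ?M x \<partial>lebesgue) / emeasure (weight_measure w) Q \<le> Ainf_char D w"
      unfolding Ainf_char_def using assms(7) by (rule SUP_upper)
  qed (use Q assms(2) emeasure_weight_measure_pos emeasure_weight_measure_finite in auto)
  finally show ?thesis by (simp add: mult.assoc mult_left_mono)
qed

lemma one_le_Ainf:
  assumes "dyadic_system D" "weight w"
  shows "1 \<le> Ainf_char D w"
proof -
  obtain Q where Q: "Q \<in> D" using dyadic_nonempty[OF assms(1)] by blast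
  note c = dyadic_cube[OF assms(1) Q]
  note e = emeasure_weight_measure_pos[OF assms(2) c(1,2)] emeasure_weight_measure_finite[OF assms(2) c(4,1)]
  let ?M = "dyadic_maximal D (\<lambda>y. indicator Q y * w y)"
  have "average w Q \<le> ?M x" if "x \<in> Q" for x
  proof -
    have "average w Q \<le> average (\<lambda>y. \<bar>indicator Q y * w y\<bar>) Q"
      unfolding average_def
      by (intro divide_right_mono_ennreal nn_integral_mono) (auto simp: indicator_def intro!: ennreal_leI)
    also have "\<dots> = average (\<lambda>y. \<bar>indicator Q y * w y\<bar>) Q * indicator Q x" using that by simp
    also have "\<dots> \<le> ?M x" unfolding dyadic_maximal_def using Q by (intro SUP_upper)
    finally show ?thesis .
  qed
  then have "(\<integral>\<^sup>+x. average w Q * indicator Q x \<partial>lebesgue) \<le> (\<integral>\<^sup>+x\<in>Q. ?M x \<partial>lebesgue)"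
    by (intro nn_integral_mono) (auto simp: indicator_def)
  moreover have "(\<integral>\<^sup>+x. average w Q * indicator Q x \<partial>lebesgue) = emeasure (weight_measure w) Q"
    unfolding nn_integral_cmult_indicator[OF c(1)]
    using c assms(2) by (simp add: average_weight ennreal_divide_times ennreal_divide_self)
  ultimately have "emeasure (weight_measure w) Q / emeasure (weight_measure w) Q
      \<le> (\<integral>\<^sup>+x\<in>Q. ?M x \<partial>lebesgue) / emeasure (weight_measure w) Q"
    by (intro divide_right_mono_ennreal) simp
  also have "\<dots> \<le> Ainf_char D w"
    unfolding Ainf_char_def using Q by (rule SUP_upper)
  finally show ?thesis using e by (simp add: ennreal_divide_self)
qed

section \<open>The mass of a level\<close>

lemma finite_ennreal_real: "x < \<infinity> \<Longrightarrow> x = ennreal (enn2real x)"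
  by (simp add: less_top)

text \<open>
  The data of the estimate at a fixed function \<open>f\<close>, with finite joint characteristic \<open>A\<close> and with
  \<open>\<Phi> = \<parallel>f\<parallel>\<^sup>p\<close>. The measures \<open>\<nu>\<close> and \<open>\<phi>\<close> introduced below are \<open>f \<sigma> dx\<close> and \<open>f powr p \<sigma> dx\<close>.
\<close>
locale two_weight_function =
  fixes D :: "(real ^ 'n) set set" and p :: real and w \<sigma> f :: "real ^ 'n \<Rightarrow> real" and A \<Phi> :: real
  assumes dyadic: "dyadic_system D" and p: "1 < p" and w: "weight w" and \<sigma>: "weight \<sigma>"
    and Ap: "Ap_char D p w \<sigma> = ennreal A" "0 \<le> A"
    and f: "f \<in> borel_measurable lebesgue" "\<And>x. 0 \<le> f x"
    and \<Phi>: "(\<integral>\<^sup>+x. ennreal (f x powr p) \<partial>weight_measure \<sigma>) = ennreal \<Phi>" "0 \<le> \<Phi>"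
begin

abbreviation "\<nu> \<equiv> density (weight_measure \<sigma>) (\<lambda>x. ennreal (f x))"
abbreviation "\<phi> \<equiv> density (weight_measure \<sigma>) (\<lambda>x. ennreal (f x powr p))"
abbreviation "avg Q \<equiv> enn2real (average (\<lambda>x. f x * \<sigma> x) Q)"

lemma f_meas: "f \<in> borel_measurable (weight_measure \<sigma>)"
  using f(1) by (simp add: weight_measure_def)

lemma emeasure_\<phi>_UNIV: "emeasure \<phi> UNIV = ennreal \<Phi>"
  using f_meas \<Phi>(1) by (subst emeasure_density) auto

lemma emeasure_\<phi>_finite: "emeasure \<phi> E < \<infinity>"
proof -
  have "emeasure \<phi> E \<le> ennreal \<Phi>" using emeasure_space[of \<phi> E] by (simp add: emeasure_\<phi>_UNIV)
  also have "\<dots> < \<infinity>" by simp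
  finally show ?thesis .
qed

lemma Holder:
  assumes "E \<in> sets lebesgue" "bounded E"
  shows "emeasure \<nu> E < \<infinity>"
    "enn2real (emeasure \<nu> E) powr p
       \<le> enn2real (emeasure (weight_measure \<sigma>) E) powr (p - 1) * enn2real (emeasure \<phi> E)"
proof -
  have "\<exists>n \<ge> 0. emeasure \<nu> E = ennreal n \<and>
      n powr p \<le> enn2real (emeasure (weight_measure \<sigma>) E) powr (p - 1) * enn2real (emeasure \<phi> E)"
  proof (rule Holder_density[OF p f_meas f(2)])
    show "emeasure (weight_measure \<sigma>) E = ennreal (enn2real (emeasure (weight_measure \<sigma>) E))"
      by (rule finite_ennreal_real[OF emeasure_weight_measure_finite[OF \<sigma> assms(2,1)]])
    show "emeasure \<phi> E = ennreal (enn2real (emeasure \<phi> E))"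
      by (rule finite_ennreal_real[OF emeasure_\<phi>_finite])
  qed (use assms in auto)
  then show "emeasure \<nu> E < \<infinity>"
    "enn2real (emeasure \<nu> E) powr p
       \<le> enn2real (emeasure (weight_measure \<sigma>) E) powr (p - 1) * enn2real (emeasure \<phi> E)"
    by auto
qed

lemma average_eq: 
  assumes "Q \<in> sets lebesgue"
  shows "average (\<lambda>x. f x * \<sigma> x) Q = emeasure \<nu> Q / emeasure lebesgue Q"
proof -
  have "emeasure \<nu> Q = (\<integral>\<^sup>+x. ennreal (f x) * indicator Q x \<partial>weight_measure \<sigma>)"
    using assms f_meas by (intro emeasure_density) auto
  also have "\<dots> = (\<integral>\<^sup>+x. ennreal (\<sigma> x) * (ennreal (f x) * indicator Q x) \<partial>lebesgue)"
    unfolding weight_measure_def using assms f(1) weight_measurable[OF \<sigma>]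
    by (intro nn_integral_density) auto
  also have "\<dots> = (\<integral>\<^sup>+x. ennreal (f x * \<sigma> x) * indicator Q x \<partial>lebesgue)"
    using f(2) by (simp add: ennreal_mult' ennreal_mult'' mult_ac)
  finally show ?thesis by (simp add: average_def)
qed

lemma average_eq_avg:
  assumes "Q \<in> D"
  shows "average (\<lambda>x. f x * \<sigma> x) Q = ennreal (avg Q)"
    "emeasure \<nu> Q = ennreal (avg Q) * emeasure lebesgue Q"
proof -
  note c = dyadic_cube[OF dyadic assms]
  have "average (\<lambda>x. f x * \<sigma> x) Q < \<infinity>"
    using c(2) Holder(1)[OF c(1,4)] unfolding average_eq[OF c(1)]
    by (auto simp: ennreal_divide_eq_top_iff less_top[symmetric])
  then show eq: "average (\<lambda>x. f x * \<sigma> x) Q = ennreal (avg Q)" by (rule finite_ennreal_real)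
  have "emeasure \<nu> Q = average (\<lambda>x. f x * \<sigma> x) Q * emeasure lebesgue Q"
    unfolding average_eq[OF c(1)] using c
    by (simp add: ennreal_divide_times ennreal_divide_self)
  also have "\<dots> = ennreal (avg Q) * emeasure lebesgue Q"
    using eq by (rule arg_cong)
  finally show "emeasure \<nu> Q = ennreal (avg Q) * emeasure lebesgue Q" .
qed

text \<open>
  On a level \<open>\<nu>\<close> and Lebesgue measure differ by a factor between \<open>L\<close> and \<open>2 L\<close>, so the
  Lebesgue packing constant \<open>2\<close> at most doubles.
\<close>
lemma carleson_level:
  assumes "sparse_family S" "finite F" "F \<subseteq> S" "S \<subseteq> D" "0 < L" "Q \<in> level avg F L"
  shows "(\<Sum>R\<in>below (level avg F L) Q. emeasure \<nu> R) \<le> of_nat 4 * emeasure \<nu> Q"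
proof -
  let ?G = "level avg F L"
  have G: "?G \<subseteq> F" "finite ?G" using assms(2) by (auto simp: level_def)
  have Q: "Q \<in> D" "L < avg Q" using assms(3,4,6) by (auto simp: level_def)
  have "(\<Sum>R\<in>below ?G Q. emeasure \<nu> R) \<le> (\<Sum>R\<in>below ?G Q. ennreal (2 * L) * emeasure lebesgue R)"
  proof (rule sum_mono)
    fix R assume "R \<in> below ?G Q"
    then have "R \<in> D" "avg R \<le> 2 * L" using assms(3,4) by (auto simp: level_def below_def)
    then show "emeasure \<nu> R \<le> ennreal (2 * L) * emeasure lebesgue R"
      using average_eq_avg(2)[of R] by (auto intro!: mult_right_mono ennreal_leI)
  qed
  also have "\<dots> \<le> ennreal (2 * L) * (2 * emeasure lebesgue Q)"
    unfolding sum_distrib_left[symmetric]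
    using carleson_lebesgue[OF G(2) _ assms(1), of Q] G(1) assms(3) dyadic_cube(1)[OF dyadic Q(1)]
    by (intro mult_left_mono) auto
  also have "\<dots> = (2 * 2) * (ennreal L * emeasure lebesgue Q)"
    using assms(5) by (simp add: ennreal_mult' mult_ac)
  also have "2 * 2 = (of_nat 4 :: ennreal)" by simp
  also have "of_nat 4 * (ennreal L * emeasure lebesgue Q) \<le> of_nat 4 * (ennreal (avg Q) * emeasure lebesgue Q)"
    using Q(2) by (intro mult_left_mono mult_right_mono ennreal_leI) auto
  also have "\<dots> = of_nat 4 * emeasure \<nu> Q" by (simp only: average_eq_avg(2)[OF Q(1)])
  finally show ?thesis .
qed

lemma Ap_real:
  assumes "Q \<in> D"
  shows "enn2real (emeasure (weight_measure w) Q) / enn2real (emeasure lebesgue Q) *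
     (enn2real (emeasure (weight_measure \<sigma>) Q) / enn2real (emeasure lebesgue Q)) powr (p - 1) \<le> A"
proof -
  note c = dyadic_cube[OF dyadic assms]
  have v: "emeasure lebesgue Q = ennreal (enn2real (emeasure lebesgue Q))" "0 < enn2real (emeasure lebesgue Q)"
    using c by (auto simp: finite_ennreal_real enn2real_positive_iff less_top)
  have avg: "average u Q = ennreal (enn2real (emeasure (weight_measure u) Q) / enn2real (emeasure lebesgue Q))"
    if "weight u" for u
  proof -
    have "average u Q = ennreal (enn2real (emeasure (weight_measure u) Q)) / ennreal (enn2real (emeasure lebesgue Q))"
      using average_weight[OF that c(1)] v(1) finite_ennreal_real[OF emeasure_weight_measure_finite[OF that c(4,1)]] by metis
    then show ?thesis using v(2) by (simp add: divide_ennreal)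
  qed
  have "average w Q * average \<sigma> Q epowr (p - 1) \<le> ennreal A"
    unfolding Ap(1)[symmetric] Ap_char_def using assms by (rule SUP_upper)
  then show ?thesis
    unfolding avg[OF w] avg[OF \<sigma>] using p Ap(2)
    by (simp add: enn_powr_def ennreal_mult'[symmetric] ennreal_le_iff)
qed

text \<open>
  With \<open>v\<close>, \<open>\<omega>\<close>, \<open>s\<close> the Lebesgue, \<open>w\<close> and \<open>\<sigma>\<close> measures of \<open>Q\<close>, and \<open>n\<close>, \<open>e\<close> the \<open>\<nu>\<close> and \<open>\<phi>\<close>
  measures of its shallow part, the chain is
  \<open>\<omega> L powr p \<le> \<omega> (2 n / v) powr p \<le> 2 powr p (\<omega> / v) (s / v) powr (p - 1) e \<le> 2 powr p A e\<close>. The depth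
  \<open>8\<close> is twice the packing constant \<open>4\<close> of \<open>\<nu>\<close> on a level.
\<close>
lemma weight_level_cube_le:
  assumes "sparse_family S" "finite F" "F \<subseteq> S" "S \<subseteq> D" "0 < L" "Q \<in> level avg F L"
  shows "emeasure (weight_measure w) Q
    \<le> ennreal (2 powr p * A * L powr - p) * emeasure \<phi> (shallow 8 (level avg F L) Q)"
proof -
  let ?G = "level avg F L"
  let ?E = "shallow 8 ?G Q"
  have G: "?G \<subseteq> D" "finite ?G" using assms(2,3,4) by (auto simp: level_def)
  have nest: "nested ?G" using nested_subset[OF nested_dyadic[OF dyadic] G(1)] .
  have meas: "?G \<subseteq> sets \<nu>" using G(1) dyadic_cube(1)[OF dyadic] by auto
  have Q: "Q \<in> D" "L < avg Q" using assms(3,4,6) by (auto simp: level_def)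
  note c = dyadic_cube[OF dyadic Q(1)]
  have E: "?E \<in> sets lebesgue" "bounded ?E"
    using shallow_measurable[OF G(2) meas assms(6)] bounded_subset[OF c(4) shallow_subset] by auto
  define v where "v = enn2real (emeasure lebesgue Q)"
  define \<omega> where "\<omega> = enn2real (emeasure (weight_measure w) Q)"
  define s where "s = enn2real (emeasure (weight_measure \<sigma>) Q)"
  define e where "e = enn2real (emeasure \<phi> ?E)"
  define n where "n = enn2real (emeasure \<nu> ?E)"
  have v: "v > 0" using c by (simp add: v_def enn2real_positive_iff less_top)
  have s: "s > 0" using emeasure_weight_measure_pos[OF \<sigma> c(1,2)] emeasure_weight_measure_finite[OF \<sigma> c(4,1)]
    by (simp add: s_def enn2real_positive_iff less_top)
  have nonneg: "0 \<le> \<omega>" "0 \<le> e" "0 \<le> n" by (simp_all add: \<omega>_def e_def n_def)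
  have "emeasure \<nu> Q \<le> 2 * emeasure \<nu> (shallow (2 * 4) ?G Q)"
    using carleson_level[OF assms(1-5)] Holder(1)[OF c(1,4)]
    by (intro emeasure_le_shallow[OF G(2) nest meas assms(6)]) auto
  then have "ennreal (avg Q * v) \<le> ennreal (2 * n)"
    using average_eq_avg(2)[OF Q(1)] finite_ennreal_real[OF c(3)] finite_ennreal_real[OF Holder(1)[OF E]]
    by (simp add: v_def n_def ennreal_mult')
  then have "avg Q * v \<le> 2 * n" using nonneg by (simp add: ennreal_le_iff)
  with Q(2) v have "L * v \<le> 2 * n" by (meson less_imp_le mult_right_mono order_trans)
  then have Ln: "L \<le> 2 * n / v" using v by (simp add: field_simps)
  have n: "n powr p \<le> s powr (p - 1) * e"
  proof -
    have "enn2real (emeasure (weight_measure \<sigma>) ?E) \<le> s"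
      unfolding s_def using emeasure_weight_measure_finite[OF \<sigma> c(4,1)] c(1)
      by (intro enn2real_mono emeasure_mono shallow_subset) (auto simp: less_top)
    then have "enn2real (emeasure (weight_measure \<sigma>) ?E) powr (p - 1) * e \<le> s powr (p - 1) * e"
      using p nonneg by (intro mult_right_mono powr_mono2) auto
    with Holder(2)[OF E] show ?thesis unfolding n_def e_def by linarith
  qed
  have "\<omega> * L powr p \<le> \<omega> * (2 * n / v) powr p"
    using Ln assms(5) p nonneg by (intro mult_left_mono powr_mono2) auto
  also have "\<dots> = 2 powr p * (\<omega> / v powr p) * n powr p"
    using v nonneg by (simp add: powr_mult powr_divide)
  also have "\<dots> \<le> 2 powr p * (\<omega> / v powr p) * (s powr (p - 1) * e)"
    using n nonneg by (intro mult_left_mono) auto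
  also have "\<dots> = 2 powr p * (\<omega> / v * (s / v) powr (p - 1)) * e"
    using v s powr_add[of v "p - 1" 1] by (simp add: powr_divide mult_ac)
  also have "\<dots> \<le> 2 powr p * A * e"
    using Ap_real[OF Q(1)] nonneg unfolding \<omega>_def v_def s_def by (intro mult_right_mono mult_left_mono) auto
  finally have "\<omega> \<le> 2 powr p * A * L powr - p * e"
    using assms(5) by (simp add: powr_minus field_simps)
  then have "ennreal \<omega> \<le> ennreal (2 powr p * A * L powr - p) * ennreal e"
    using Ap(2) nonneg by (simp add: ennreal_mult'[symmetric] ennreal_leI)
  moreover have "emeasure (weight_measure w) Q = ennreal \<omega>"
    unfolding \<omega>_def by (rule finite_ennreal_real[OF emeasure_weight_measure_finite[OF w c(4,1)]])
  moreover have "emeasure \<phi> ?E = ennreal e"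
    unfolding e_def by (rule finite_ennreal_real[OF emeasure_\<phi>_finite])
  ultimately show ?thesis by simp
qed

lemma weight_level_sum_le:
  assumes "sparse_family S" "finite F" "F \<subseteq> S" "S \<subseteq> D" "0 < L"
  shows "(\<Sum>Q\<in>level avg F L. emeasure (weight_measure w) Q)
    \<le> ennreal (8 * 2 powr p * A * \<Phi> * L powr - p)"
proof -
  let ?G = "level avg F L" and ?c = "ennreal (2 powr p * A * L powr - p)"
  have G: "?G \<subseteq> D" "finite ?G" using assms(2,3,4) by (auto simp: level_def)
  have "(\<Sum>Q\<in>?G. emeasure (weight_measure w) Q) \<le> (\<Sum>Q\<in>?G. ?c * emeasure \<phi> (shallow 8 ?G Q))"
    by (intro sum_mono weight_level_cube_le[OF assms])
  also have "\<dots> = ?c * (\<Sum>Q\<in>?G. emeasure \<phi> (shallow 8 ?G Q))"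
    by (rule sum_distrib_left[symmetric])
  also have "\<dots> \<le> ?c * (of_nat 8 * emeasure \<phi> (space \<phi>))"
    using nested_subset[OF nested_dyadic[OF dyadic] G(1)] G dyadic_cube(1)[OF dyadic]
    by (intro mult_left_mono sum_emeasure_shallow_le) auto
  also have "\<dots> = ennreal (2 powr p * A * L powr - p) * (ennreal 8 * ennreal \<Phi>)"
    by (simp add: emeasure_\<phi>_UNIV)
  also have "\<dots> = ennreal (8 * 2 powr p * A * \<Phi> * L powr - p)"
    using Ap(2) \<Phi>(2) by (simp add: ennreal_mult'[symmetric] mult_ac del: ennreal_numeral)
  finally show ?thesis .
qed

end

section \<open>From finite sums to the weak norm\<close>

lemma epowr_ennreal: "0 \<le> u \<Longrightarrow> a \<noteq> 0 \<Longrightarrow> ennreal u epowr a = ennreal (u powr a)"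
  by (simp add: enn_powr_def)

lemma epowr_pos: "0 < x \<Longrightarrow> 0 < x epowr a"
  using enn2real_positive_iff[of x] by (auto simp: enn_powr_def less_top)

lemma epowr_mono:
  assumes "x \<le> y" "0 \<le> a"
  shows "x epowr a \<le> y epowr a"
proof (cases "y = \<infinity> \<or> a = 0")
  case False
  then have "y < \<infinity>" by (simp add: less_top)
  moreover from this have "x < \<infinity>" using assms(1) by (rule order.strict_trans1[rotated])
  ultimately obtain u v where "x = ennreal u" "y = ennreal v" "0 \<le> u" "0 \<le> v"
    by (metis finite_ennreal_real enn2real_nonneg)
  then show ?thesis using False assms by (auto simp: epowr_ennreal ennreal_le_iff intro!: ennreal_leI powr_mono2)
qed (auto simp: enn_powr_def)

lemma less_epowr_imp:
  assumes "ennreal t < s epowr (1 / r)" "0 < r" "0 < t"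
  shows "ennreal (t powr r) < s"
proof (rule ccontr)
  assume "\<not> ennreal (t powr r) < s"
  then have "s epowr (1 / r) \<le> ennreal (t powr r) epowr (1 / r)"
    using assms(2) by (intro epowr_mono) auto
  also have "\<dots> = ennreal t" using assms by (simp add: epowr_ennreal powr_powr)
  finally show False using assms(1) by simp
qed

text \<open>
  A countable family is exhausted by finite ones. The sum exceeds \<open>t powr r\<close> as soon as some finite
  partial sum does, so continuity of the measure from below transfers the bound.
\<close>
lemma weak_Lp_norm_sparse_operator_le:
  fixes M :: "(real ^ 'n) measure"
  assumes S: "countable S" "S \<subseteq> sets M" and r: "0 < r" and p: "0 < p" and B: "0 \<le> B"
    and a: "\<And>Q. Q \<in> S \<Longrightarrow> average g Q = ennreal (a Q)" "\<And>Q. 0 \<le> a Q"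
    and bound: "\<And>F t. finite F \<Longrightarrow> F \<subseteq> S \<Longrightarrow> 0 < t \<Longrightarrow>
      emeasure M {x \<in> space M. (\<Sum>Q\<in>F. a Q powr r * indicator Q x) > t powr r} \<le> ennreal (B * t powr - p)"
  shows "weak_Lp_norm p M (sparse_operator r S g) \<le> ennreal (B powr (1 / p))"
  unfolding weak_Lp_norm_def
proof (rule SUP_least)
  fix t :: real assume "t \<in> {0<..}"
  then have t: "t > 0" by simp
  define F where "F n = {Q \<in> S. to_nat_on S Q < n}" for n
  have finF: "finite (F n)" for n
  proof (rule finite_imageD)
    show "finite (to_nat_on S ` F n)" by (rule finite_subset[of _ "{..<n}"]) (auto simp: F_def)
    show "inj_on (to_nat_on S) (F n)"
      using inj_on_to_nat_on[OF S(1)] by (rule inj_on_subset) (auto simp: F_def)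
  qed
  have subF: "F n \<subseteq> S" for n by (auto simp: F_def)
  define U where "U n = {x \<in> space M. (\<Sum>Q\<in>F n. a Q powr r * indicator Q x) > t powr r}" for n
  have Umeas: "U n \<in> sets M" for n
  proof -
    have "(\<lambda>x. \<Sum>Q\<in>F n. a Q powr r * indicator Q x :: real) \<in> borel_measurable M"
      using subF[of n] S(2) by (intro borel_measurable_sum borel_measurable_times borel_measurable_const borel_measurable_indicator) auto
    then show ?thesis unfolding U_def by measurable
  qed
  have "incseq U"
  proof (rule incseq_SucI, rule subsetI)
    fix n x assume x: "x \<in> U n"
    have "(\<Sum>Q\<in>F n. a Q powr r * indicator Q x) \<le> (\<Sum>Q\<in>F (Suc n). a Q powr r * indicator Q x)"
      using finF by (intro sum_mono2) (auto simp: F_def)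
    with x show "x \<in> U (Suc n)" by (auto simp: U_def)
  qed
  have sub: "{x \<in> space M. ennreal t < sparse_operator r S g x} \<subseteq> (\<Union>n. U n)"
  proof
    fix x assume x: "x \<in> {x \<in> space M. ennreal t < sparse_operator r S g x}"
    let ?h = "\<lambda>Q. average g Q epowr r * indicator Q x"
    have "ennreal (t powr r) < (\<Sum>\<^sub>\<infinity>Q\<in>S. ?h Q)"
      using x less_epowr_imp[OF _ r t] unfolding sparse_operator_def by blast
    also have "\<dots> = (SUP F\<in>{F. finite F \<and> F \<subseteq> S}. sum ?h F)"
      by (rule nonneg_infsum_complete) simp
    finally obtain H where H: "finite H" "H \<subseteq> S" "ennreal (t powr r) < sum ?h H"
      by (auto simp: less_SUP_iff)
    have "sum ?h H = (\<Sum>Q\<in>H. ennreal (a Q powr r * indicator Q x))"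
      using H(2) r a by (intro sum.cong) (auto simp: epowr_ennreal indicator_def)
    also have "\<dots> = ennreal (\<Sum>Q\<in>H. a Q powr r * indicator Q x)"
      by (intro sum_ennreal) auto
    finally have "t powr r < (\<Sum>Q\<in>H. a Q powr r * indicator Q x)"
      using H(3) by (simp add: ennreal_less_iff)
    also have "\<dots> \<le> (\<Sum>Q\<in>F (Suc (Max (to_nat_on S ` H))). a Q powr r * indicator Q x)"
    proof (rule sum_mono2[OF finF])
      show "H \<subseteq> F (Suc (Max (to_nat_on S ` H)))"
        using H(1,2) by (auto simp: F_def less_Suc_eq_le)
    qed simp
    finally show "x \<in> (\<Union>n. U n)" using x by (auto simp: U_def)
  qed
  have "emeasure M {x \<in> space M. ennreal t < sparse_operator r S g x} \<le> emeasure M (\<Union>n. U n)"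
    using sub Umeas by (intro emeasure_mono) auto
  also have "\<dots> = (SUP n. emeasure M (U n))"
    using Umeas \<open>incseq U\<close> by (intro SUP_emeasure_incseq[symmetric]) auto
  also have "\<dots> \<le> ennreal (B * t powr - p)"
    unfolding U_def using bound[OF finF subF t] by (intro SUP_least) auto
  finally have "ennreal t * emeasure M {x \<in> space M. ennreal t < sparse_operator r S g x} epowr (1 / p)
      \<le> ennreal t * ennreal (B * t powr - p) epowr (1 / p)"
    using p by (intro mult_left_mono epowr_mono) auto
  also have "\<dots> = ennreal (t * (B * t powr - p) powr (1 / p))"
    using p B t by (simp add: epowr_ennreal[of "B * t powr - p"] ennreal_mult'[of t])
  also have "t * (B * t powr - p) powr (1 / p) = B powr (1 / p)"
  proof -
    have "(t powr - p) powr (1 / p) = inverse t"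
      unfolding powr_powr using p t by (simp add: powr_minus)
    then show ?thesis using B t by (simp add: powr_mult)
  qed
  finally show "ennreal t * emeasure M {x \<in> space M. ennreal t < sparse_operator r S g x} epowr (1 / p)
      \<le> ennreal (B powr (1 / p))" .
qed

section \<open>The weak-type estimate\<close>

text \<open>
  The estimate for finite joint characteristic \<open>A\<close>, with the tail bounds on the overlaps as a
  hypothesis. It covers \<open>r < p\<close> and \<open>p < r\<close> alike; the two cases differ only in \<open>m\<close>, \<open>n\<close>,
  \<open>B\<close> and \<open>W\<close>.
\<close>
lemma sparse_weak_type_finite_char:
  fixes D :: "(real ^ 'n) set set" and p r B :: real and m n :: nat
  assumes "dyadic_system D" "1 < p" "0 < r" "real m * r < p" "p < real n * r" "0 < B"
  shows "\<exists>C > 0. \<forall>S w \<sigma> A W. S \<subseteq> D \<and> sparse_family S \<and> weight w \<and> weight \<sigma> \<and>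
    0 \<le> A \<and> Ap_char D p w \<sigma> = ennreal A \<and> 0 < W \<and> tail_bound (weight_measure w) S m n B W \<longrightarrow>
    sparse_operator_norm r p S \<sigma> w \<le> ennreal (C * A powr (1 / p) * W powr (1 / r - real m / p))"
proof -
  obtain C where C: "C > 0" and level: "\<forall>(M :: (real ^ 'n) measure) F a (W :: real) (X :: real) (t :: real).
    finite F \<and> F \<subseteq> sets M \<and> (\<forall>Q\<in>F. 0 \<le> a Q) \<and> 0 < W \<and> 0 \<le> X \<and> 0 < t \<and>
    (\<forall>L > 0. (\<Sum>Q\<in>level a F L. emeasure M Q) \<le> ennreal (X * L powr - p)) \<and>
    tail_bound M F m n B W \<longrightarrow>
    emeasure M {x \<in> space M. (\<Sum>Q\<in>F. a Q powr r * indicator Q x) > t powr r}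
      \<le> ennreal (C * W powr (p / r - real m) * X * t powr - p)"
    using emeasure_level_sum_le[OF assms(3-6), where 'a = "real ^ 'n"] by (elim exE conjE) (rule that)
  define C' where "C' = (C * 8 * 2 powr p) powr (1 / p)"
  have C': "C' > 0" using C by (simp add: C'_def)
  show ?thesis
  proof (intro exI[of _ C'] conjI allI impI C'; elim conjE)
    fix S and w \<sigma> :: "real ^ 'n \<Rightarrow> real" and A W :: real
    assume S: "S \<subseteq> D" "sparse_family S" and w: "weight w" and \<sigma>: "weight \<sigma>"
      and A: "0 \<le> A" "Ap_char D p w \<sigma> = ennreal A" and W: "0 < W"
      and tail: "tail_bound (weight_measure w) S m n B W"
    show "sparse_operator_norm r p S \<sigma> w \<le> ennreal (C' * A powr (1 / p) * W powr (1 / r - real m / p))"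
      unfolding sparse_operator_norm_def
    proof (rule Inf_lower, rule CollectI, intro ballI impI)
      fix f assume f: "f \<in> Lp_space p (weight_measure \<sigma>)" "\<forall>x. 0 \<le> f x"
      have "(\<integral>\<^sup>+x. ennreal (\<bar>f x\<bar> powr p) \<partial>weight_measure \<sigma>) epowr (1 / p) < \<infinity>"
        using f(1) by (simp add: Lp_space_def Lp_norm_def)
      then have "(\<integral>\<^sup>+x. ennreal (f x powr p) \<partial>weight_measure \<sigma>) < \<infinity>"
        using f(2) assms(2) by (auto simp: enn_powr_def less_top split: if_splits)
      then obtain \<Phi> where \<Phi>: "(\<integral>\<^sup>+x. ennreal (f x powr p) \<partial>weight_measure \<sigma>) = ennreal \<Phi>" "0 \<le> \<Phi>"
        using finite_ennreal_real enn2real_nonneg by blast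
      have norm: "Lp_norm p (weight_measure \<sigma>) f = ennreal (\<Phi> powr (1 / p))"
        using \<Phi> f(2) assms(2) by (simp add: Lp_norm_def epowr_ennreal)
      interpret two_weight_function D p w \<sigma> f A \<Phi>
        using assms(1,2) w \<sigma> A f \<Phi> by unfold_locales (auto simp: Lp_space_def weight_measure_def)
      let ?X = "8 * 2 powr p * A * \<Phi>"
      have "weak_Lp_norm p (weight_measure w) (sparse_operator r S (\<lambda>x. f x * \<sigma> x))
          \<le> ennreal ((C * W powr (p / r - real m) * ?X) powr (1 / p))"
      proof (rule weak_Lp_norm_sparse_operator_le)
        show "countable S" using countable_subset[OF S(1) countable_dyadic[OF assms(1)]] .
        show "S \<subseteq> sets (weight_measure w)" using S(1) dyadic_cube(1)[OF assms(1)] by auto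
        show "average (\<lambda>x. f x * \<sigma> x) Q = ennreal (avg Q)" if "Q \<in> S" for Q
          using average_eq_avg(1) that S(1) by blast
        fix F and t :: real assume F: "finite F" "F \<subseteq> S" and t: "0 < t"
        show "emeasure (weight_measure w) {x \<in> space (weight_measure w). t powr r < (\<Sum>Q\<in>F. avg Q powr r * indicator Q x)}
          \<le> ennreal (C * W powr (p / r - real m) * ?X * t powr - p)"
        proof (rule level[rule_format], intro conjI)
          show "F \<subseteq> sets (weight_measure w)" using F(2) S(1) dyadic_cube(1)[OF assms(1)] by auto
          show "\<forall>L>0. (\<Sum>Q\<in>level avg F L. emeasure (weight_measure w) Q) \<le> ennreal (?X * L powr - p)"
            using weight_level_sum_le[OF S(2) F S(1)] by blast
          show "tail_bound (weight_measure w) F m n B W"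
            using tail F(2) unfolding tail_bound_def by (meson order_trans)
        qed (use F W A \<Phi> t in auto)
      qed (use assms(2,3) C W A \<Phi> in auto)
      also have "(C * W powr (p / r - real m) * ?X) powr (1 / p)
          = C' * A powr (1 / p) * W powr (1 / r - real m / p) * \<Phi> powr (1 / p)"
        using C W A \<Phi> assms(2,3) by (simp add: C'_def powr_mult powr_powr diff_divide_distrib mult_ac)
      also have "ennreal \<dots> = ennreal (C' * A powr (1 / p) * W powr (1 / r - real m / p)) * Lp_norm p (weight_measure \<sigma>) f"
        unfolding norm using C' by (intro ennreal_mult) auto
      finally show "weak_Lp_norm p (weight_measure w) (sparse_operator r S (\<lambda>x. f x * \<sigma> x))
        \<le> ennreal (C' * A powr (1 / p) * W powr (1 / r - real m / p)) * Lp_norm p (weight_measure \<sigma>) f" .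
    qed
  qed
qed

text \<open>
  Without this, the right side of the theorem could be \<open>0 * \<infinity> = 0\<close> when \<open>w\<close> has infinite
  \<open>A\<^sub>\<infinity>\<close> characteristic.
\<close>
lemma Ap_char_pos:
  assumes "dyadic_system D" "weight w" "weight \<sigma>"
  shows "0 < Ap_char D p w \<sigma>"
proof -
  obtain Q where Q: "Q \<in> D" using dyadic_nonempty[OF assms(1)] by blast
  note c = dyadic_cube[OF assms(1) Q]
  have avg: "0 < average u Q" "average u Q < \<infinity>" if "weight u" for u
    using emeasure_weight_measure_pos[OF that c(1,2)] emeasure_weight_measure_finite[OF that c(4,1)] c
    by (simp_all add: average_weight[OF that c(1)] ennreal_zero_less_divide ennreal_divide_eq_top_iff less_top[symmetric] zero_less_iff_neq_zero)
  have "0 < average \<sigma> Q epowr (p - 1)"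
    using avg(1)[OF assms(3)] by (rule epowr_pos)
  then have "0 < average w Q * average \<sigma> Q epowr (p - 1)"
    using avg(1)[OF assms(2)] by (simp add: ennreal_zero_less_mult_iff)
  also have "\<dots> \<le> Ap_char D p w \<sigma>" unfolding Ap_char_def using Q by (rule SUP_upper)
  finally show ?thesis .
qed

lemma overlap_tail_weight:
  fixes D :: "(real ^ 'n) set set"
  assumes "dyadic_system D" "weight w" "S \<subseteq> D" "sparse_family S" "finite F" "F \<subseteq> S" "0 < l"
  shows "emeasure (weight_measure w) {x \<in> space (weight_measure w). real (overlap F x) > l}
     \<le> ennreal (fact (Suc q) * l powr - real (Suc q)) * (2 * Ainf_char D w) ^ q * (\<Sum>Q\<in>F. emeasure (weight_measure w) Q)"
proof -
  have F: "F \<subseteq> D" using assms(3,6) by blast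
  show ?thesis
  proof (rule emeasure_overlap_gt[OF assms(5) nested_subset[OF nested_dyadic[OF assms(1)] F] _ _ assms(7)])
    show "F \<subseteq> sets (weight_measure w)" using F dyadic_cube(1)[OF assms(1)] by auto
    fix Q assume "Q \<in> F"
    then show "(\<Sum>R\<in>below F Q. emeasure (weight_measure w) R) \<le> 2 * Ainf_char D w * emeasure (weight_measure w) Q"
      using F by (intro carleson_weight[OF assms(1-6)]) auto
  qed
qed

text \<open>
  Exponent \<open>0\<close> is subadditivity, and exponent \<open>1\<close> is the first moment, where the packing
  constant occurs to the power \<open>0\<close>; hence the scale is \<open>1\<close> for every \<open>w\<close>.
\<close>
lemma tail_bound_weight:
  fixes D :: "(real ^ 'n) set set"
  assumes "dyadic_system D" "weight w" "S \<subseteq> D" "sparse_family S"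
  shows "tail_bound (weight_measure w) S 0 1 1 1"
  unfolding tail_bound_def
proof (intro allI impI; elim conjE)
  fix F :: "(real ^ 'n) set set" and l :: real and q :: nat
  assume F: "finite F" "F \<subseteq> S" "0 < l" and q: "q \<in> {0, 1}"
  let ?e = "emeasure (weight_measure w) {x \<in> space (weight_measure w). real (overlap F x) > l}"
  have "F \<subseteq> sets (weight_measure w)" using F(2) assms(3) dyadic_cube(1)[OF assms(1)] by auto
  then have 0: "?e \<le> (\<Sum>Q\<in>F. emeasure (weight_measure w) Q)"
    using F by (intro emeasure_overlap_pos) auto
  have 1: "?e \<le> ennreal (l powr - 1) * (\<Sum>Q\<in>F. emeasure (weight_measure w) Q)"
    using overlap_tail_weight[OF assms F, of 0] by simp
  show "?e \<le> ennreal (1 * 1 powr (real q - real 0) * l powr - real q) * (\<Sum>Q\<in>F. emeasure (weight_measure w) Q)"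
    using q 0 1 F(3) by auto
qed

lemma tail_bound_weight_Ainf:
  fixes D :: "(real ^ 'n) set set"
  assumes "dyadic_system D" "weight w" "S \<subseteq> D" "sparse_family S" "Ainf_char D w = ennreal W" "0 < W"
  shows "tail_bound (weight_measure w) S 1 (Suc k) (fact (Suc k) * 2 ^ k) W"
  unfolding tail_bound_def
proof (intro allI impI; elim conjE)
  fix F :: "(real ^ 'n) set set" and l :: real and q :: nat
  assume F: "finite F" "F \<subseteq> S" "0 < l" and q: "q \<in> {1, Suc k}"
  let ?s = "\<Sum>Q\<in>F. emeasure (weight_measure w) Q"
  define j where "j = q - 1"
  have j: "q = Suc j" "j \<le> k" using q by (auto simp: j_def)
  have W: "W powr (real q - real 1) = W ^ j"
    using assms(6) j(1) by (simp add: powr_realpow)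
  have "ennreal (fact q * l powr - real q) * (2 * Ainf_char D w) ^ j
      = ennreal (fact q * l powr - real q * (2 * W) ^ j)"
  proof -
    have "(2 * Ainf_char D w) ^ j = ennreal ((2 * W) ^ j)"
      using assms(5,6) by (simp add: ennreal_mult' flip: ennreal_power)
    then show ?thesis by (simp add: ennreal_mult')
  qed
  also have "\<dots> \<le> ennreal (fact (Suc k) * 2 ^ k * W powr (real q - real 1) * l powr - real q)"
  proof (rule ennreal_leI)
    have "(fact q :: real) * 2 ^ j \<le> fact (Suc k) * 2 ^ k"
      using j by (intro mult_mono fact_mono power_increasing) auto
    then have "fact q * 2 ^ j * (W ^ j * l powr - real q) \<le> fact (Suc k) * 2 ^ k * (W ^ j * l powr - real q)"
      using assms(6) by (intro mult_right_mono) auto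
    then show "fact q * l powr - real q * (2 * W) ^ j \<le> fact (Suc k) * 2 ^ k * W powr (real q - real 1) * l powr - real q"
      unfolding W by (simp add: power_mult_distrib mult_ac del: fact_Suc)
  qed
  finally have "ennreal (fact q * l powr - real q) * (2 * Ainf_char D w) ^ j * ?s
      \<le> ennreal (fact (Suc k) * 2 ^ k * W powr (real q - real 1) * l powr - real q) * ?s"
    by (rule mult_right_mono) simp
  then show "emeasure (weight_measure w) {x \<in> space (weight_measure w). real (overlap F x) > l}
      \<le> ennreal (fact (Suc k) * 2 ^ k * W powr (real q - real 1) * l powr - real q) * ?s"
    using overlap_tail_weight[OF assms(1-4) F, of j] unfolding j(1) by (rule order_trans[rotated])
qed

theorem theorem1p2:
  fixes D :: "(real ^ 'n) set set" and p r :: real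
  assumes "dyadic_system D"
    and "1 < p" and "0 < r" and "p \<noteq> r"
  shows "\<exists>C :: real. 0 < C \<and>
           (\<forall>S w \<sigma>. S \<subseteq> D \<and> sparse_family S \<and> weight w \<and> weight \<sigma> \<longrightarrow>
              sparse_operator_norm r p S \<sigma> w
                \<le> ennreal C * Ap_char D p w \<sigma> epowr (1 / p)
                    * Ainf_char D w epowr (max (1 / r - 1 / p) 0))"
proof (cases "r < p")
  case True
  obtain k :: nat where "p / r < real k" using reals_Archimedean2 by blast
  then have k: "p < real (Suc k) * r" using assms(3) by (simp add: field_simps)
  have r1: "real 1 * r < p" using True by simp
  have ex: "max (1 / r - 1 / p) 0 = 1 / r - 1 / p" and expos: "1 / r - 1 / p > 0"
    using True assms(2,3) by (auto simp: field_simps)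
  have B: "0 < (fact (Suc k) * 2 ^ k :: real)" by simp
  obtain C where C: "C > 0" and norm: "\<forall>S w \<sigma> A W. S \<subseteq> D \<and> sparse_family S \<and> weight w \<and> weight \<sigma> \<and>
      0 \<le> A \<and> Ap_char D p w \<sigma> = ennreal A \<and> 0 < W \<and>
      tail_bound (weight_measure w) S 1 (Suc k) (fact (Suc k) * 2 ^ k) W \<longrightarrow>
      sparse_operator_norm r p S \<sigma> w \<le> ennreal (C * A powr (1 / p) * W powr (1 / r - real 1 / p))"
    using sparse_weak_type_finite_char[OF assms(1-3) r1 k B] by (elim exE conjE) (rule that)
  show ?thesis
  proof (intro exI[of _ C] conjI allI impI C; elim conjE)
    fix S and w \<sigma> :: "real ^ 'n \<Rightarrow> real"
    assume S: "S \<subseteq> D" "sparse_family S" "weight w" "weight \<sigma>"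
    have A1: "1 \<le> Ainf_char D w" by (rule one_le_Ainf[OF assms(1) S(3)])
    show "sparse_operator_norm r p S \<sigma> w \<le> ennreal C * Ap_char D p w \<sigma> epowr (1 / p) * Ainf_char D w epowr (max (1 / r - 1 / p) 0)"
    proof (cases "Ap_char D p w \<sigma> < \<infinity> \<and> Ainf_char D w < \<infinity>")
      case True
      define A where "A = enn2real (Ap_char D p w \<sigma>)"
      define W where "W = enn2real (Ainf_char D w)"
      have A: "Ap_char D p w \<sigma> = ennreal A" "0 \<le> A"
        unfolding A_def using True by (auto intro: finite_ennreal_real)
      have W: "Ainf_char D w = ennreal W"
        unfolding W_def using True by (auto intro: finite_ennreal_real)
      with A1 have W1: "1 \<le> W" by simp
      then have "sparse_operator_norm r p S \<sigma> w \<le> ennreal (C * A powr (1 / p) * W powr (1 / r - real 1 / p))"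
        using S A tail_bound_weight_Ainf[OF assms(1) S(3,1,2) W, of k]
        by (intro norm[rule_format] conjI) auto
      also have "\<dots> = ennreal C * Ap_char D p w \<sigma> epowr (1 / p) * Ainf_char D w epowr (max (1 / r - 1 / p) 0)"
      proof -
        have "ennreal W epowr (1 / r - 1 / p) = ennreal (W powr (1 / r - 1 / p))"
          using W1 expos by (intro epowr_ennreal) auto
        then show ?thesis
          unfolding ex A(1) W using A(2) C assms(2) by (simp add: epowr_ennreal ennreal_mult')
      qed
      finally show ?thesis .
    next
      case False
      have inf: "\<infinity> epowr (1 / p) = \<infinity>" "\<infinity> epowr (1 / r - 1 / p) = \<infinity>"
        using assms(2,4) expos by (auto simp: enn_powr_def)
      have "Ap_char D p w \<sigma> epowr (1 / p) \<noteq> 0" "Ainf_char D w epowr (1 / r - 1 / p) \<noteq> 0"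
        using epowr_pos[OF Ap_char_pos[OF assms(1) S(3,4)]] epowr_pos[OF order.strict_trans2[OF zero_less_one A1]]
        by (metis less_irrefl)+
      moreover have "Ap_char D p w \<sigma> epowr (1 / p) = \<infinity> \<or> Ainf_char D w epowr (1 / r - 1 / p) = \<infinity>"
      proof -
        have "Ap_char D p w \<sigma> = \<infinity> \<or> Ainf_char D w = \<infinity>" using False by (auto simp: less_top[symmetric])
        then show ?thesis using inf by metis
      qed
      ultimately have "ennreal C * Ap_char D p w \<sigma> epowr (1 / p) * Ainf_char D w epowr (max (1 / r - 1 / p) 0) = \<infinity>"
        unfolding ex using C by (auto simp: ennreal_mult_eq_top_iff ennreal_eq_0_iff)
      then show ?thesis by simp
    qed
  qed
next
  case False
  with assms(4) have pr: "real 0 * r < p" "p < real 1 * r" using assms(2) by auto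
  have ex: "max (1 / r - 1 / p) 0 = 0"
    using pr assms(2,3) by (simp add: field_simps max_def)
  obtain C where C: "C > 0" and norm: "\<forall>S w \<sigma> A W. S \<subseteq> D \<and> sparse_family S \<and> weight w \<and> weight \<sigma> \<and>
      0 \<le> A \<and> Ap_char D p w \<sigma> = ennreal A \<and> 0 < W \<and>
      tail_bound (weight_measure w) S 0 1 1 W \<longrightarrow>
      sparse_operator_norm r p S \<sigma> w \<le> ennreal (C * A powr (1 / p) * W powr (1 / r - real 0 / p))"
    using sparse_weak_type_finite_char[OF assms(1-3) pr zero_less_one] by (elim exE conjE) (rule that)
  show ?thesis
  proof (intro exI[of _ C] conjI allI impI C; elim conjE)
    fix S and w \<sigma> :: "real ^ 'n \<Rightarrow> real"
    assume S: "S \<subseteq> D" "sparse_family S" "weight w" "weight \<sigma>"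
    show "sparse_operator_norm r p S \<sigma> w \<le> ennreal C * Ap_char D p w \<sigma> epowr (1 / p) * Ainf_char D w epowr (max (1 / r - 1 / p) 0)"
    proof (cases "Ap_char D p w \<sigma> < \<infinity>")
      case True
      define A where "A = enn2real (Ap_char D p w \<sigma>)"
      have A: "Ap_char D p w \<sigma> = ennreal A" "0 \<le> A"
        unfolding A_def using True by (auto intro: finite_ennreal_real)
      have "sparse_operator_norm r p S \<sigma> w \<le> ennreal (C * A powr (1 / p) * 1 powr (1 / r - real 0 / p))"
        using S A tail_bound_weight[OF assms(1) S(3,1,2)]
        by (intro norm[rule_format] conjI) auto
      also have "\<dots> = ennreal C * Ap_char D p w \<sigma> epowr (1 / p) * Ainf_char D w epowr (max (1 / r - 1 / p) 0)"
        unfolding ex A(1) using A(2) C assms(2) by (simp add: epowr_ennreal ennreal_mult' enn_powr_def[of _ 0])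
      finally show ?thesis .
    next
      case False
      then have "ennreal C * Ap_char D p w \<sigma> epowr (1 / p) * Ainf_char D w epowr (max (1 / r - 1 / p) 0) = \<infinity>"
        unfolding ex using C assms(2)
        by (auto simp: enn_powr_def less_top[symmetric] ennreal_mult_eq_top_iff ennreal_eq_0_iff)
      then show ?thesis by simp
    qed
  qed
qed

end
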